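(* It is decidable whether a regular forest language is cca-piecewise testable; i.e. there is an algorithm which, given a regular forest language $L$ over a finite alphabet $A$, decides whether $L$ is cca-piecewise testable.
   Context: Forests over a finite alphabet $A$ are finite, ordered, unranked, $A$-labelled forests (finite sequences of trees, the empty forest allowed). Contexts over $A$ are forests over $A\cup\{\Box\}$ with exactly one node, a leaf, labelled $\Box$ (the hole). The closest common ancestor of nodes $x,y$ (if it exists) is the common ancestor (each node counting as an ancestor of itself) that is a descendant of all other common ancestors. A forest $s$ is a cca-piece of $t$ if there is an injective label-preserving map from nodes of $s$ to nodes of $t$ preserving the depth-first left-first order and the closest common ancestor relation; equivalently, $s$ is obtained from $t$ by repeatedly deleting a leaf or a node with exactly one child. $L$ is cca-piecewise testable if there is $n>0$ such that membership of $t$ in $L$ depends only on the set of cca-pieces of $t$ with at most $n$ nodes. A forest algebra is a pair $(H,V)$ of monoids, $H$ additive (not necessarily commutative), $V$ multiplicative with identity $\Box$, with a faithful monoidal left action of $V$ on $H$ and elements $g+\Box,\Box+g\in V$ for each $g\in H$ acting by $h\mapsto g+h$, $h\mapsto h+g$. $A^\Delta$ is the free forest algebra of forests (under concatenation) and contexts (under substitution in the hole) over $A$; a morphism $A^\Delta\to(H,V)$ is determined by the images of the contexts $a\Box$, $a\in A$. A regular forest language is one of the form $\alpha^{-1}(X)$ with $\alpha:A^\Delta\to(H,V)$ a morphism to a finite forest algebra and $X\subseteq H$; as input it is given by such $(H,V)$, $\alpha$, $X$ (or any effectively equivalent representation). *)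

theory Defs
  imports "HOL-Algebra.Group" "HOL-Library.Nat_Bijection" "HOL-Library.Sublist"
begin

datatype 'a tree = Node (root_label: 'a) (children: "'a tree list")

type_synonym 'a forest = "'a tree list"

definition forests :: "'a set \<Rightarrow> 'a forest set" where
  "forests A = {t. \<forall>u \<in> set t. set_tree u \<subseteq> A}"

text \<open>
  A node is addressed by the nonempty list of sibling positions (counted from 0) met on
  the way down to it. Thus \<^term>\<open>prefix x y\<close> says that \<open>x\<close> is an ancestor of \<open>y\<close> or
  \<open>y\<close> itself, and the lexicographic order on addresses, in which proper prefixes come
  first, is the depth-first left-first order.
\<close>

fun subtree_at :: "'a forest \<Rightarrow> nat list \<Rightarrow> 'a tree option" where
  "subtree_at t [] = None"
| "subtree_at t (i # p) =
     (if i < length t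
      then if p = [] then Some (t ! i) else subtree_at (children (t ! i)) p
      else None)"

definition nodes :: "'a forest \<Rightarrow> nat list set" where
  "nodes t = {x. subtree_at t x \<noteq> None}"

definition label :: "'a forest \<Rightarrow> nat list \<Rightarrow> 'a" where
  "label t x = root_label (the (subtree_at t x))"

definition is_leaf :: "'a forest \<Rightarrow> nat list \<Rightarrow> bool" where
  "is_leaf t x \<longleftrightarrow> x \<in> nodes t \<and> children (the (subtree_at t x)) = []"

definition before :: "nat list \<Rightarrow> nat list \<Rightarrow> bool" where
  "before x y \<longleftrightarrow> (x, y) \<in> lexord {(i, j). i < j}"

text \<open>In contexts the label \<^const>\<open>None\<close> plays the role of the hole.\<close>

type_synonym 'a cntxt = "'a option forest"

definition contexts :: "'a set \<Rightarrow> 'a cntxt set" where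
  "contexts A = {c \<in> forests (insert None (Some ` A)).
     \<exists>x. {y \<in> nodes c. label c y = None} = {x} \<and> is_leaf c x}"

definition hole :: "'a cntxt" where
  "hole = [Node None []]"

text \<open>
  Replacing the hole by a forest \<open>g\<close>, where \<open>e\<close> embeds the remaining labels into the label
  type of \<open>g\<close>. Taking \<open>e = id\<close> and \<open>e = Some\<close> gives the action of contexts on forests and
  the composition of contexts.
\<close>

primrec fill_tree :: "('a \<Rightarrow> 'b) \<Rightarrow> 'b forest \<Rightarrow> 'a option tree \<Rightarrow> 'b forest" where
  "fill_tree e g (Node l ts) =
     (case l of None \<Rightarrow> g | Some a \<Rightarrow> [Node (e a) (concat (map (fill_tree e g) ts))])"

definition fill :: "('a \<Rightarrow> 'b) \<Rightarrow> 'a cntxt \<Rightarrow> 'b forest \<Rightarrow> 'b forest" where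
  "fill e c g = concat (map (fill_tree e g) c)"

definition as_hole_free :: "'a forest \<Rightarrow> 'a cntxt" where
  "as_hole_free t = map (map_tree Some) t"

definition is_cca :: "'a forest \<Rightarrow> nat list \<Rightarrow> nat list \<Rightarrow> nat list \<Rightarrow> bool" where
  "is_cca t x y z \<longleftrightarrow> z \<in> nodes t \<and> prefix z x \<and> prefix z y \<and>
     (\<forall>w \<in> nodes t. prefix w x \<and> prefix w y \<longrightarrow> prefix w z)"

text \<open>
  The closest common ancestor is a partial operation, undefined for nodes of different
  trees. The last clause asks \<open>\<phi>\<close> to preserve its value where it is defined, and also the
  fact that it is undefined. Without the second half, two trees \<open>a\<close> and \<open>b\<close> side by side
  would be a piece of a tree with root \<open>c\<close> and children \<open>a\<close>, \<open>b\<close>, although they are not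
  obtained from it by deleting leaves and nodes with exactly one child.
\<close>

definition cca_embedding ::
  "'a forest \<Rightarrow> 'a forest \<Rightarrow> (nat list \<Rightarrow> nat list) \<Rightarrow> bool" where
  "cca_embedding s t \<phi> \<longleftrightarrow>
     inj_on \<phi> (nodes s) \<and> \<phi> ` nodes s \<subseteq> nodes t \<and>
     (\<forall>x \<in> nodes s. label t (\<phi> x) = label s x) \<and>
     (\<forall>x \<in> nodes s. \<forall>y \<in> nodes s. before x y \<longrightarrow> before (\<phi> x) (\<phi> y)) \<and>
     (\<forall>x \<in> nodes s. \<forall>y \<in> nodes s. {z. is_cca t (\<phi> x) (\<phi> y) z} = \<phi> ` {z. is_cca s x y z})"

definition cca_piece :: "'a forest \<Rightarrow> 'a forest \<Rightarrow> bool" where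
  "cca_piece s t \<longleftrightarrow> (\<exists>\<phi>. cca_embedding s t \<phi>)"

definition cca_pieces :: "nat \<Rightarrow> 'a forest \<Rightarrow> 'a forest set" where
  "cca_pieces n t = {s. cca_piece s t \<and> card (nodes s) \<le> n}"

definition cca_piecewise_testable :: "'a set \<Rightarrow> 'a forest set \<Rightarrow> bool" where
  "cca_piecewise_testable A L \<longleftrightarrow>
     (\<exists>n > 0. \<forall>s \<in> forests A. \<forall>t \<in> forests A.
        cca_pieces n s = cca_pieces n t \<longrightarrow> (s \<in> L \<longleftrightarrow> t \<in> L))"

text \<open>
  The horizontal monoid is written additively in the literature, but its operation and
  unit are the fields \<^const>\<open>mult\<close> and \<^const>\<open>one\<close> here. The contexts \<open>g + \<box>\<close> and
  \<open>\<box> + g\<close> are \<open>ins_left F g\<close> and \<open>ins_right F g\<close>.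
\<close>

record ('h, 'v) forest_alg =
  horiz :: "'h monoid"
  vert :: "'v monoid"
  act :: "'v \<Rightarrow> 'h \<Rightarrow> 'h"
  ins_left :: "'h \<Rightarrow> 'v"
  ins_right :: "'h \<Rightarrow> 'v"

locale forest_algebra =
  fixes F :: "('h, 'v) forest_alg"
  assumes horiz_monoid: "monoid (horiz F)"
    and vert_monoid: "monoid (vert F)"
    and act_closed: "\<lbrakk>v \<in> carrier (vert F); h \<in> carrier (horiz F)\<rbrakk>
      \<Longrightarrow> act F v h \<in> carrier (horiz F)"
    and act_one: "h \<in> carrier (horiz F) \<Longrightarrow> act F \<one>\<^bsub>vert F\<^esub> h = h"
    and act_mult: "\<lbrakk>v \<in> carrier (vert F); w \<in> carrier (vert F); h \<in> carrier (horiz F)\<rbrakk>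
      \<Longrightarrow> act F (v \<otimes>\<^bsub>vert F\<^esub> w) h = act F v (act F w h)"
    and faithful: "\<lbrakk>v \<in> carrier (vert F); w \<in> carrier (vert F);
        \<forall>h \<in> carrier (horiz F). act F v h = act F w h\<rbrakk> \<Longrightarrow> v = w"
    and ins_left_closed: "g \<in> carrier (horiz F) \<Longrightarrow> ins_left F g \<in> carrier (vert F)"
    and ins_right_closed: "g \<in> carrier (horiz F) \<Longrightarrow> ins_right F g \<in> carrier (vert F)"
    and act_ins_left: "\<lbrakk>g \<in> carrier (horiz F); h \<in> carrier (horiz F)\<rbrakk>
      \<Longrightarrow> act F (ins_left F g) h = g \<otimes>\<^bsub>horiz F\<^esub> h"
    and act_ins_right: "\<lbrakk>g \<in> carrier (horiz F); h \<in> carrier (horiz F)\<rbrakk>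
      \<Longrightarrow> act F (ins_right F g) h = h \<otimes>\<^bsub>horiz F\<^esub> g"

definition free_forest_algebra :: "'a set \<Rightarrow> ('a forest, 'a cntxt) forest_alg" where
  "free_forest_algebra A =
     \<lparr>horiz = \<lparr>carrier = forests A, mult = (@), one = []\<rparr>,
      vert = \<lparr>carrier = contexts A, mult = fill Some, one = hole\<rparr>,
      act = fill id,
      ins_left = (\<lambda>g. as_hole_free g @ hole),
      ins_right = (\<lambda>g. hole @ as_hole_free g)\<rparr>"

definition monoid_morphism :: "'a monoid \<Rightarrow> 'b monoid \<Rightarrow> ('a \<Rightarrow> 'b) \<Rightarrow> bool" where
  "monoid_morphism M N f \<longleftrightarrow> f \<in> hom M N \<and> f \<one>\<^bsub>M\<^esub> = \<one>\<^bsub>N\<^esub>"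

definition forest_algebra_morphism ::
  "('g, 'u) forest_alg \<Rightarrow> ('h, 'v) forest_alg \<Rightarrow> ('g \<Rightarrow> 'h) \<Rightarrow> ('u \<Rightarrow> 'v) \<Rightarrow> bool" where
  "forest_algebra_morphism E F \<gamma> \<delta> \<longleftrightarrow>
     monoid_morphism (horiz E) (horiz F) \<gamma> \<and>
     monoid_morphism (vert E) (vert F) \<delta> \<and>
     (\<forall>v \<in> carrier (vert E). \<forall>h \<in> carrier (horiz E). \<gamma> (act E v h) = act F (\<delta> v) (\<gamma> h)) \<and>
     (\<forall>g \<in> carrier (horiz E). \<delta> (ins_left E g) = ins_left F (\<gamma> g)) \<and>
     (\<forall>g \<in> carrier (horiz E). \<delta> (ins_right E g) = ins_right F (\<gamma> g))"

definition letter :: "'a \<Rightarrow> 'a cntxt" where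
  "letter a = [Node (Some a) hole]"

definition encode_fun :: "nat \<Rightarrow> (nat \<Rightarrow> nat) \<Rightarrow> nat" where
  "encode_fun m f = list_encode (map f [0..<m])"

definition encode_fun2 :: "nat \<Rightarrow> nat \<Rightarrow> (nat \<Rightarrow> nat \<Rightarrow> nat) \<Rightarrow> nat" where
  "encode_fun2 m n f = encode_fun m (\<lambda>i. encode_fun n (f i))"

text \<open>
  The code of a forest algebra with carriers \<open>{..<m}\<close> and \<open>{..<n}\<close>, of the images
  \<open>\<delta> (letter a)\<close> of the letters \<open>a < k\<close>, which determine the morphism, and of the
  accepting set \<open>X\<close>.
\<close>

definition encode_presentation ::
  "nat \<Rightarrow> nat \<Rightarrow> nat \<Rightarrow> (nat, nat) forest_alg \<Rightarrow> (nat cntxt \<Rightarrow> nat) \<Rightarrow> nat set \<Rightarrow> nat" where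
  "encode_presentation k m n F \<delta> X = list_encode
     [k, m, n,
      \<one>\<^bsub>horiz F\<^esub>, encode_fun2 m m (mult (horiz F)),
      \<one>\<^bsub>vert F\<^esub>, encode_fun2 n n (mult (vert F)),
      encode_fun2 n m (act F),
      encode_fun m (ins_left F), encode_fun m (ins_right F),
      encode_fun k (\<lambda>a. \<delta> (letter a)),
      encode_fun m (\<lambda>h. of_bool (h \<in> X))]"

text \<open>
  \<open>c\<close> presents the regular forest language \<open>L\<close> over the alphabet \<open>{..<k}\<close>. Up to renaming,
  every finite alphabet is of this form, and every finite forest algebra has initial
  segments of the natural numbers as carriers.
\<close>

definition presents_regular_language :: "nat \<Rightarrow> nat \<Rightarrow> nat forest set \<Rightarrow> bool" where
  "presents_regular_language c k L \<longleftrightarrow>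
     (\<exists>m n F \<gamma> \<delta> X.
        forest_algebra F \<and> carrier (horiz F) = {..<m} \<and> carrier (vert F) = {..<n} \<and>
        forest_algebra_morphism (free_forest_algebra {..<k}) F \<gamma> \<delta> \<and>
        X \<subseteq> carrier (horiz F) \<and>
        L = {t \<in> forests {..<k}. \<gamma> t \<in> X} \<and>
        c = encode_presentation k m n F \<delta> X)"

text \<open>
  The model of computation: programs for Kleene's partial recursive functions on the natural
  numbers. \<open>computes p xs y\<close> says that \<open>p\<close> halts on the arguments \<open>xs\<close> with result \<open>y\<close>.
  Arities are implicit, and there is no result where an argument list does not fit.
\<close>

datatype recf =
    Zero
  | Succ
  | Proj nat
  | Comp recf "recf list"
  | Prim_Rec recf recf
  | Minimize recf

inductive computes :: "recf \<Rightarrow> nat list \<Rightarrow> nat \<Rightarrow> bool" where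
  zero: "computes Zero xs 0"
| succ: "computes Succ [x] (Suc x)"
| proj: "i < length xs \<Longrightarrow> computes (Proj i) xs (xs ! i)"
| comp: "\<lbrakk>list_all2 (\<lambda>g y. computes g xs y) gs ys; computes f ys z\<rbrakk>
    \<Longrightarrow> computes (Comp f gs) xs z"
| prim_rec_0: "computes f xs y \<Longrightarrow> computes (Prim_Rec f g) (0 # xs) y"
| prim_rec_Suc: "\<lbrakk>computes (Prim_Rec f g) (n # xs) y; computes g (n # y # xs) z\<rbrakk>
    \<Longrightarrow> computes (Prim_Rec f g) (Suc n # xs) z"
| minimize: "\<lbrakk>computes f (n # xs) 0; \<forall>i < n. \<exists>y > 0. computes f (i # xs) y\<rbrakk>
    \<Longrightarrow> computes (Minimize f) xs n"

lemma computes_deterministic: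
  assumes "computes p xs y" "computes p xs z"
  shows "y = z"
  using assms
proof (induction arbitrary: z rule: computes.induct)
  case (zero xs)
  then show ?case by cases simp
next
  case (succ x)
  then show ?case by cases simp
next
  case (proj i xs)
  from proj.prems show ?case by cases simp
next
  case (comp xs gs ys f w)
  from comp.prems obtain ys' where ys': "list_all2 (\<lambda>g y. computes g xs y) gs ys'"
    and "computes f ys' z"
    by cases simp
  moreover have "ys = ys'"
    using comp.IH(1) ys' by (auto simp: list_all2_conv_all_nth intro!: nth_equalityI)
  ultimately show ?case
    using comp.IH(2) by simp
next
  case (prim_rec_0 f xs y g)
  from prim_rec_0.prems show ?case
    by cases (use prim_rec_0.IH in simp)
next
  case (prim_rec_Suc f g n xs y w)
  from prim_rec_Suc.prems obtain y' where "computes (Prim_Rec f g) (n # xs) y'"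
    and "computes g (n # y' # xs) z"
    by cases simp
  then show ?case
    using prim_rec_Suc.IH by metis
next
  case (minimize f n xs)
  from minimize.prems have z: "computes f (z # xs) 0" "\<forall>i < z. \<exists>y > 0. computes f (i # xs) y"
    by (cases, simp)+
  have "\<not> z < n"
    using minimize.IH(2) z(1) by (metis less_irrefl)
  moreover have "\<not> n < z"
    using minimize.IH(1) z(2) by (metis less_irrefl)
  ultimately show ?case
    by simp
qed

end

theory Submission
  imports Defs "HOL-Library.Infinite_Set"
begin

text \<open>
  The cca-piece relation is Kruskal's homeomorphic embedding, a well-quasi-order on the forests
  over a finite alphabet. Call a set \<open>D\<close> of forests alternating if every member of \<open>D\<close> embeds
  both into a member of \<open>D\<close> that lies in \<open>L\<close> and into one that does not. A nonempty alternating
  set refutes testability, because a member with the largest possible set of small pieces has the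
  same small pieces as all larger members. Conversely, by well-founded induction on
  downward closed sets \<open>E\<close>, if no nonempty downward closed set is alternating then the small
  pieces decide membership in \<open>L\<close> on each \<open>E\<close>: remove from \<open>E\<close> the forests above some \<open>t\<close> such
  that \<open>L\<close> or its complement misses all of them.

  Since a downward closed set excludes finitely many minimal forests, it is regular. Hence both
  testability and the existence of a nonempty alternating set are witnessed by finite tables whose
  correctness is a bounded arithmetical condition, and one searches for a witness of either kind.
\<close>

section \<open>Computable functions\<close>

text \<open>Kruskal's theorem yields no bound on the size of the pieces that decide a testable
  language, and a nonempty alternating set is infinite. No search space is bounded in advance, so
  termination rests only on the fact that one of the two kinds of witness exists.

  The difficulty is that checking a witness may use bounded quantifiers only, whereas its meaning
  concerns all forests. Forests are therefore read as binary trees (first child, next sibling) and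
  evaluated by automata: \<open>s a x y\<close> is the value of a forest whose first root is
  \<open>a\<close>, with \<open>x\<close> the value of its children and \<open>y\<close> that of its
  remaining siblings. Universal claims become closure conditions on transition tables, which pass to
  all forests by induction. Existential claims, such as that some larger forest has a given value,
  become tables with ranks that exclude circular justification. The set of values attained above a
  forest is not in general a function of its state, whence a second automaton. Its table may list
  fewer values than are attained: soundness needs that listed values are attained, and completeness
  exhibits a table that lists enough.\<close>

definition computable :: "(nat \<Rightarrow> nat) \<Rightarrow> bool" where
  "computable f \<longleftrightarrow> (\<exists>p. \<forall>x. computes p [x] (f x))"

definition computable2 :: "(nat \<Rightarrow> nat \<Rightarrow> nat) \<Rightarrow> bool" where
  "computable2 f \<longleftrightarrow> (\<exists>p. \<forall>x y. computes p [x, y] (f x y))"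

abbreviation decidable :: "(nat \<Rightarrow> bool) \<Rightarrow> bool" where
  "decidable P \<equiv> computable (\<lambda>x. of_bool (P x))"

lemma computes_Proj: "i < length xs \<Longrightarrow> y = xs ! i \<Longrightarrow> computes (Proj i) xs y"
  using computes.proj by simp

lemma computes_Comp1: "computes g xs y \<Longrightarrow> computes f [y] z \<Longrightarrow> computes (Comp f [g]) xs z"
  by (rule computes.comp[where ys = "[y]"]) auto

lemma computes_Comp2:
  "computes g xs y \<Longrightarrow> computes h xs z \<Longrightarrow> computes f [y, z] w \<Longrightarrow> computes (Comp f [g, h]) xs w"
  by (rule computes.comp[where ys = "[y, z]"]) auto

lemma computes_Prim_Rec:
  assumes "computes f xs a" "\<And>n y. computes g (n # y # xs) (G n y)"
  shows "computes (Prim_Rec f g) (n # xs) (rec_nat a G n)"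
  by (induction n) (auto intro: computes.intros assms)

lemma computable_ident: "computable (\<lambda>x. x)"
  unfolding computable_def by (rule exI[of _ "Proj 0"]) (auto intro!: computes_Proj)

lemma computable_comp:
  assumes "computable f" "computable g"
  shows "computable (\<lambda>x. f (g x))"
  using assms unfolding computable_def by (meson computes_Comp1)

lemma computable_comp2:
  assumes "computable2 f" "computable g" "computable h"
  shows "computable (\<lambda>x. f (g x) (h x))"
  using assms unfolding computable_def computable2_def by (meson computes_Comp2)

lemma computable_Suc: "computable f \<Longrightarrow> computable (\<lambda>x. Suc (f x))"
  by (rule computable_comp[of Suc]) (auto simp: computable_def intro: computes.succ)

lemma computable_const: "computable (\<lambda>x. n)"
proof (induction n)
  case 0
  show ?case
    unfolding computable_def using computes.zero by blast
qed (rule computable_Suc)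

lemma computable2_add: "computable2 (+)"
proof -
  have "computes (Prim_Rec (Proj 0) (Comp Succ [Proj 1])) [x, y] (rec_nat y (\<lambda>n. Suc) x)" for x y
    by (rule computes_Prim_Rec) (auto intro!: computes_Proj computes_Comp1 computes.succ)
  moreover have "rec_nat y (\<lambda>n. Suc) x = x + y" for x y :: nat
    by (induction x) auto
  ultimately show ?thesis
    unfolding computable2_def by metis
qed

lemma computable2_mult: "computable2 (*)"
proof -
  obtain p where p: "computes p [x, y] (x + y)" for x y
    using computable2_add unfolding computable2_def by blast
  have "computes (Prim_Rec Zero (Comp p [Proj 1, Proj 2])) [x, y] (rec_nat 0 (\<lambda>n z. z + y) x)" for x y
    by (rule computes_Prim_Rec) (auto intro!: computes_Proj computes_Comp2 p computes.zero)
  moreover have "rec_nat 0 (\<lambda>n z. z + y) x = x * y" for x y :: nat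
    by (induction x) auto
  ultimately show ?thesis
    unfolding computable2_def by metis
qed

lemma computable2_swap: "computable2 f \<Longrightarrow> computable2 (\<lambda>x y. f y x)"
  unfolding computable2_def
  by (elim exE, rule_tac x = "Comp p [Proj 1, Proj 0]" in exI)
     (auto intro!: computes_Comp2 computes_Proj)

lemma computable_pred: "computable (\<lambda>x. x - 1)"
proof -
  have "computes (Prim_Rec Zero (Proj 0)) [x] (rec_nat 0 (\<lambda>n y. n) x)" for x
    by (rule computes_Prim_Rec) (auto intro!: computes_Proj computes.zero)
  moreover have "rec_nat 0 (\<lambda>n y. n) x = x - 1" for x :: nat
    by (cases x) auto
  ultimately show ?thesis
    unfolding computable_def by metis
qed

lemma computable2_diff: "computable2 (-)"
proof -
  obtain p where p: "computes p [x] (x - 1)" for x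
    using computable_pred unfolding computable_def by blast
  \<comment> \<open>Recursion runs on the first argument, so that argument has to be the subtrahend;
    the swap at the end restores the order.\<close>
  have "computes (Prim_Rec (Proj 0) (Comp p [Proj 1])) [x, y] (rec_nat y (\<lambda>n z. z - 1) x)" for x y
    by (rule computes_Prim_Rec) (auto intro!: computes_Proj computes_Comp1 p[simplified])
  moreover have "rec_nat y (\<lambda>n z. z - 1) x = y - x" for x y :: nat
    by (induction x) auto
  ultimately have "computable2 (\<lambda>x y. y - x)"
    unfolding computable2_def by metis
  then show ?thesis
    by (rule computable2_swap)
qed

lemmas computable_arith =
  computable_comp2[OF computable2_add] computable_comp2[OF computable2_mult]
  computable_comp2[OF computable2_diff]

section \<open>Pairing and recursion for unary functions\<close>

lemma computable_triangle:
  assumes "computable f"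
  shows "computable (\<lambda>x. triangle (f x))"
proof -
  obtain p where p: "computes p [x, y] (x + y)" for x y
    using computable2_add unfolding computable2_def by blast
  have "computes (Prim_Rec Zero (Comp p [Proj 1, Comp Succ [Proj 0]])) [x]
      (rec_nat 0 (\<lambda>n z. z + Suc n) x)" for x
    by (rule computes_Prim_Rec)
       (auto intro!: computes_Proj computes_Comp1 computes_Comp2 p[of _ "Suc _", simplified]
         computes.succ computes.zero)
  moreover have "rec_nat 0 (\<lambda>n z. z + Suc n) x = triangle x" for x :: nat
    by (induction x) auto
  ultimately have "computable triangle"
    unfolding computable_def by metis
  then show ?thesis
    using assms by (rule computable_comp)
qed

lemma computable2_prod_encode: "computable2 (\<lambda>x y. prod_encode (x, y))"
proof -
  obtain p where p: "computes p [x, y] (x + y)" for x y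
    using computable2_add unfolding computable2_def by blast
  obtain t where t: "computes t [x] (triangle x)" for x
    using computable_triangle[OF computable_ident] unfolding computable_def by blast
  have "computes (Comp p [Comp t [p], Proj 0]) [x, y] (prod_encode (x, y))" for x y
    unfolding prod_encode_def
    by (auto intro!: computes_Comp1 computes_Comp2 computes_Proj p t)
  then show ?thesis
    unfolding computable2_def by blast
qed

lemmas computable_prod_encode = computable_comp2[OF computable2_prod_encode]

lemma computes_Minimize:
  assumes "\<And>n. computes p [n, x] (f n)" "\<exists>n. f n = 0"
  shows "computes (Minimize p) [x] (LEAST n. f n = 0)"
proof (rule computes.minimize)
  show "computes p [LEAST n. f n = 0, x] 0"
    using assms(1) LeastI_ex[OF assms(2)] by metis
  show "\<forall>i<LEAST n. f n = 0. \<exists>y>0. computes p [i, x] y"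
    using assms(1) not_less_Least by blast
qed

lemma triangle_mono: "m \<le> n \<Longrightarrow> triangle m \<le> triangle n"
  by (rule lift_Suc_mono_le[of triangle]) auto

lemma computable_prod_decode:
  assumes "computable f"
  shows "computable (\<lambda>x. fst (prod_decode (f x)))" "computable (\<lambda>x. snd (prod_decode (f x)))"
proof -
  \<comment> \<open>The code of \<open>(m, n)\<close> is \<open>triangle (m + n) + m\<close>. Hence
    \<open>m + n\<close> is the least \<open>s\<close> for which the code lies below
    \<open>triangle (Suc s)\<close>. Truncated subtraction turns this inequality into an equation
    with zero, as minimization requires.\<close>
  let ?s = "\<lambda>z. LEAST s. Suc z - triangle (Suc s) = 0"
  have s: "?s z = m + n" if "prod_decode z = (m, n)" for z m n
  proof (rule Least_equality)
    have z: "z = triangle (m + n) + m"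
      using arg_cong[OF that, of prod_encode, unfolded prod_decode_inverse] by (simp add: prod_encode_def)
    then show "Suc z - triangle (Suc (m + n)) = 0"
      by simp
    fix y assume "Suc z - triangle (Suc y) = 0"
    then show "m + n \<le> y"
      using z triangle_mono[of "Suc y" "m + n"] by (cases "m + n \<le> y") auto
  qed
  have "\<exists>n. Suc z - triangle (Suc n) = 0" for z
    by (rule exI[of _ z]) simp
  moreover obtain d where d: "computes d [x, y] (x - y)" for x y
    using computable2_diff unfolding computable2_def by blast
  moreover obtain t where t: "computes t [x] (triangle (Suc x))" for x
    using computable_triangle[OF computable_Suc[OF computable_ident]] unfolding computable_def by blast
  have "computes (Comp d [Comp Succ [Proj 1], Comp t [Proj 0]]) [n, x] (Suc x - triangle (Suc n))" for n x
    by (rule computes_Comp2[OF computes_Comp1[OF _ computes.succ] computes_Comp1[OF _ t] d])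
       (auto intro!: computes_Proj)
  ultimately have "computable ?s"
    unfolding computable_def using computes_Minimize by meson
  then have c: "computable (\<lambda>z. z - triangle (?s z))" "computable (\<lambda>z. ?s z - (z - triangle (?s z)))"
    by (intro computable_arith computable_triangle computable_ident; assumption)+
  have e: "fst (prod_decode z) = z - triangle (?s z) \<and> snd (prod_decode z) = ?s z - (z - triangle (?s z))" for z
  proof -
    obtain m n where mn: "prod_decode z = (m, n)"
      by force
    then have "z = triangle (m + n) + m"
      using arg_cong[OF mn, of prod_encode, unfolded prod_decode_inverse] by (simp add: prod_encode_def)
    then have "z - triangle (m + n) = m"
      by simp
    then show ?thesis
      unfolding s[OF mn] using mn by simp
  qed
  show "computable (\<lambda>x. fst (prod_decode (f x)))" "computable (\<lambda>x. snd (prod_decode (f x)))"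
    using computable_comp[OF c(1) assms] computable_comp[OF c(2) assms] by (simp_all only: e)
qed

text \<open>The step function receives parameter, counter and previous value as one nested pair. All
  hypotheses thus concern unary functions, and recursions can be nested to any depth.\<close>

lemma computable_rec_nat:
  assumes "computable f" "computable b"
    and "computable (\<lambda>z. g (fst (prod_decode z)) (fst (prod_decode (snd (prod_decode z))))
      (snd (prod_decode (snd (prod_decode z)))))"
  shows "computable (\<lambda>x. rec_nat (f x) (g x) (b x))"
proof -
  obtain pf pb pg where p: "computes pf [x] (f x)" "computes pb [x] (b x)"
    "computes pg [z] (g (fst (prod_decode z)) (fst (prod_decode (snd (prod_decode z))))
      (snd (prod_decode (snd (prod_decode z)))))" for x z
    using assms unfolding computable_def by metis
  have g: "computes pg [prod_encode (x, prod_encode (n, y))] (g x n y)" for x n y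
    using p(3)[of "prod_encode (x, prod_encode (n, y))"] by simp
  obtain e where e: "computes e [x, y] (prod_encode (x, y))" for x y
    using computable2_prod_encode unfolding computable2_def by blast
  have "computes (Comp (Prim_Rec pf (Comp pg [Comp e [Proj 2, Comp e [Proj 0, Proj 1]]])) [pb, Proj 0])
      [x] (rec_nat (f x) (g x) (b x))" for x
    by (rule computes_Comp2[OF p(2) computes_Proj computes_Prim_Rec[OF p(1)
        computes_Comp1[OF computes_Comp2[OF _ computes_Comp2[OF _ _ e] e] g]]])
       (auto intro!: computes_Proj)
  then show ?thesis
    unfolding computable_def by blast
qed

section \<open>Decidable predicates and bounded quantifiers\<close>

lemma decidable_conj: "decidable P \<Longrightarrow> decidable Q \<Longrightarrow> decidable (\<lambda>x. P x \<and> Q x)"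
  using computable_arith(2)[of "\<lambda>x. of_bool (P x)" "\<lambda>x. of_bool (Q x)"]
  by (simp add: of_bool_conj)

lemma nat_of_bool_not: "of_bool (\<not> P) = (1::nat) - of_bool P"
  by simp

lemma decidable_not: "decidable P \<Longrightarrow> decidable (\<lambda>x. \<not> P x)"
  using computable_arith(3)[OF computable_const[of 1], of "\<lambda>x. of_bool (P x)"]
  by (simp only: of_bool_not_iff of_bool_eq_0_iff flip: nat_of_bool_not)

lemma decidable_disj: "decidable P \<Longrightarrow> decidable Q \<Longrightarrow> decidable (\<lambda>x. P x \<or> Q x)"
  using decidable_not[OF decidable_conj[OF decidable_not decidable_not], of P Q] by simp

lemma decidable_imp: "decidable P \<Longrightarrow> decidable Q \<Longrightarrow> decidable (\<lambda>x. P x \<longrightarrow> Q x)"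
  using decidable_disj[OF decidable_not, of P Q] by simp

lemma decidable_iff: "decidable P \<Longrightarrow> decidable Q \<Longrightarrow> decidable (\<lambda>x. P x \<longleftrightarrow> Q x)"
  using decidable_conj[OF decidable_imp decidable_imp, of P Q Q P] by (simp only: iff_conv_conj_imp)

lemma decidable_less:
  assumes "computable f" "computable g"
  shows "decidable (\<lambda>x. f x < g x)"
proof -
  have "of_bool (m < n) = (1::nat) - (1 - (n - m))" for m n :: nat
    by auto
  then show ?thesis
    using assms by (simp only:) (intro computable_arith computable_const)
qed

lemma decidable_eq:
  assumes "computable f" "computable g"
  shows "decidable (\<lambda>x. f x = g x)"
  using decidable_conj[OF decidable_not[OF decidable_less[OF assms]]
      decidable_not[OF decidable_less[OF assms(2,1)]]]
  by (simp add: not_less eq_iff conj_commute)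

text \<open>The truth value is the product of the truth values of the instances. The bound variable
  is paired with the parameter, so each nested quantifier adds one pairing and all predicates stay
  unary.\<close>

lemma decidable_All_less:
  assumes "computable b" "decidable (\<lambda>z. P (fst (prod_decode z)) (snd (prod_decode z)))"
  shows "decidable (\<lambda>x. \<forall>i<b x. P x i)"
proof -
  have "of_bool (\<forall>i<n. Q i) = rec_nat (1::nat) (\<lambda>i y. y * of_bool (Q i)) n" for Q n
    by (induction n) (simp_all add: All_less_Suc of_bool_conj ac_simps)
  moreover have "computable (\<lambda>x. rec_nat 1 (\<lambda>i y. y * of_bool (P x i)) (b x))"
  proof (rule computable_rec_nat)
    \<comment> \<open>The recursion hands over a triple. Its last component, the product so far, is
      dropped to get back to the pair that the hypothesis on \<open>P\<close> decodes.\<close>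
    have "decidable (\<lambda>z. P (fst (prod_decode z)) (fst (prod_decode (snd (prod_decode z)))))"
      using computable_comp[OF assms(2), of "\<lambda>z. prod_encode (fst (prod_decode z), fst (prod_decode (snd (prod_decode z))))"]
      by (simp add: computable_prod_encode computable_prod_decode computable_ident)
    then show "computable (\<lambda>z. snd (prod_decode (snd (prod_decode z))) *
        of_bool (P (fst (prod_decode z)) (fst (prod_decode (snd (prod_decode z))))))"
      by (intro computable_arith computable_prod_decode computable_ident)
  qed (use assms in \<open>auto intro: computable_const\<close>)
  ultimately show ?thesis
    by simp
qed

lemma decidable_Ex_less:
  assumes "computable b" "decidable (\<lambda>z. P (fst (prod_decode z)) (snd (prod_decode z)))"
  shows "decidable (\<lambda>x. \<exists>i<b x. P x i)"
  using decidable_not[OF decidable_All_less[OF assms(1) decidable_not[OF assms(2)]]] by simp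

section \<open>Codes of lists and tables\<close>

definition code_tl :: "nat \<Rightarrow> nat" where
  "code_tl l = snd (prod_decode (l - 1))"

text \<open>Total; meaningless entries are returned beyond the end of the list.\<close>

definition code_nth :: "nat \<Rightarrow> nat \<Rightarrow> nat" (infixl "$" 100) where
  "l $ i = fst (prod_decode (rec_nat l (\<lambda>_. code_tl) i - 1))"

lemma code_nth: "i < length xs \<Longrightarrow> list_encode xs $ i = xs ! i"
proof -
  assume i: "i < length xs"
  have "rec_nat (list_encode xs) (\<lambda>_. code_tl) i = list_encode (drop i xs)" if "i \<le> length xs" for i
    using that
  proof (induction i)
    case (Suc i)
    then have "drop i xs = xs ! i # drop (Suc i) xs"
      by (simp add: Cons_nth_drop_Suc)
    then show ?case
      using Suc by (simp add: code_tl_def del: drop_Suc)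
  qed simp
  moreover have "drop i xs = xs ! i # drop (Suc i) xs"
    using i by (simp add: Cons_nth_drop_Suc)
  ultimately show ?thesis
    using i by (simp add: code_nth_def)
qed

lemma computable_code_nth:
  assumes "computable f" "computable g"
  shows "computable (\<lambda>x. f x $ g x)"
  unfolding code_nth_def code_tl_def
  by (intro computable_prod_decode computable_arith computable_rec_nat computable_const
      computable_ident assms)

lemmas computable_intros =
  decidable_conj decidable_disj decidable_imp decidable_iff decidable_not decidable_less decidable_eq
  decidable_All_less decidable_Ex_less
  computable_code_nth computable_prod_decode computable_const computable_ident

lemma code_nth_list_fun: "i < n \<Longrightarrow> list_encode (map f [0..<n]) $ i = f i"
  by (simp add: code_nth)

text \<open>This and the next three lemmas supply the witnesses of the search. A function on a
  finite box is a list whose entries are again codes of lists, one level for each argument; values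
  outside the box are left open.\<close>

lemma table1: "\<exists>w. \<forall>i<m. w $ i = f i"
  using code_nth_list_fun by blast

lemma table2: "\<exists>w. \<forall>i<m. \<forall>j<n. w $ i $ j = f i j"
proof -
  have "\<forall>i. \<exists>w. \<forall>j<n. w $ j = f i j"
    using table1 by blast
  then obtain v where "\<forall>i. \<forall>j<n. v i $ j = f i j"
    by (rule choice[THEN exE])
  moreover obtain w where "\<forall>i<m. w $ i = v i"
    using table1 by blast
  ultimately show ?thesis
    by (intro exI[of _ w]) simp
qed

lemma table3: "\<exists>w. \<forall>i<m. \<forall>j<n. \<forall>k<p. w $ i $ j $ k = f i j k"
proof -
  have "\<forall>i. \<exists>w. \<forall>j<n. \<forall>k<p. w $ j $ k = f i j k"
    using table2 by blast
  then obtain v where "\<forall>i. \<forall>j<n. \<forall>k<p. v i $ j $ k = f i j k"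
    by (rule choice[THEN exE])
  moreover obtain w where "\<forall>i<m. w $ i = v i"
    using table1 by blast
  ultimately show ?thesis
    by (intro exI[of _ w]) simp
qed

lemma table4: "\<exists>w. \<forall>i<m. \<forall>j<n. \<forall>k<p. \<forall>l<q. w $ i $ j $ k $ l = f i j k l"
proof -
  have "\<forall>i. \<exists>w. \<forall>j<n. \<forall>k<p. \<forall>l<q. w $ j $ k $ l = f i j k l"
    using table3 by blast
  then obtain v where "\<forall>i. \<forall>j<n. \<forall>k<p. \<forall>l<q. v i $ j $ k $ l = f i j k l"
    by (rule choice[THEN exE])
  moreover obtain w where "\<forall>i<m. w $ i = v i"
    using table1 by blast
  ultimately show ?thesis
    by (intro exI[of _ w]) simp
qed

section \<open>Pieces as homeomorphic embeddings\<close>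

fun fsize :: "'a forest \<Rightarrow> nat" where
  "fsize [] = 0"
| "fsize (Node a f # g) = Suc (fsize f + fsize g)"

text \<open>Kruskal's homeomorphic embedding.\<close>

inductive emb :: "'a forest \<Rightarrow> 'a forest \<Rightarrow> bool" where
  Nil: "emb [] t"
| skip: "emb s t \<Longrightarrow> emb s (v # t)"
| match: "emb f f' \<Longrightarrow> emb g g' \<Longrightarrow> emb (Node a f # g) (Node a f' # g')"
| descend: "emb [u] f' \<Longrightarrow> emb g g' \<Longrightarrow> emb (u # g) (Node b f' # g')"

text \<open>In the reading as binary trees, children and later siblings are the two subtrees, so one
  induction covers trees and forests alike.\<close>

lemma forest_induct [case_names Nil Cons]:
  assumes "P []" "\<And>a f g. P f \<Longrightarrow> P g \<Longrightarrow> P (Node a f # g)"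
  shows "P t"
  using assms by (rule fsize.induct)

section \<open>Closest common ancestors as longest common prefixes of addresses\<close>

abbreviation lcp :: "'a list \<Rightarrow> 'a list \<Rightarrow> 'a list" where
  "lcp \<equiv> longest_common_prefix"

lemma lcp_Nil [simp]: "lcp [] y = []" "lcp x [] = []"
  by (cases x; simp)+

lemma lcp_idem [simp]: "lcp x x = x"
  by (induction x) auto

lemma prefix_lcp_iff: "prefix z (lcp x y) \<longleftrightarrow> prefix z x \<and> prefix z y"
  by (meson longest_common_prefix_max_prefix longest_common_prefix_prefix1
      longest_common_prefix_prefix2 prefix_order.trans)

lemma lcp_eq_iff_prefix: "lcp x y = x \<longleftrightarrow> prefix x y"
  by (metis longest_common_prefix_prefix1 prefix_lcp_iff prefix_order.antisym prefix_order.order_refl)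

lemma Nil_notin_nodes [simp]: "[] \<notin> nodes t"
  by (simp add: nodes_def)

lemma nodes_ne: "x \<in> nodes t \<Longrightarrow> x \<noteq> []"
  by auto

lemma subtree_at_Nil [simp]: "subtree_at [] x = None"
  by (cases x) auto

lemma nodes_Nil [simp]: "nodes [] = {}"
  by (simp add: nodes_def)

lemma nodes_Cons:
  "i # p \<in> nodes (u # g) \<longleftrightarrow>
    (case i of 0 \<Rightarrow> p = [] \<or> p \<in> nodes (children u) | Suc j \<Rightarrow> j # p \<in> nodes g)"
  by (auto simp: nodes_def split: nat.splits)

lemma label_Cons:
  "label (u # g) (i # p) = (case i of 0 \<Rightarrow> if p = [] then root_label u else label (children u) p
    | Suc j \<Rightarrow> label g (j # p))"
  by (auto simp: label_def split: nat.splits)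

lemma nodes_prefix_closed: "x \<in> nodes t \<Longrightarrow> prefix z x \<Longrightarrow> z \<noteq> [] \<Longrightarrow> z \<in> nodes t"
proof (induction t arbitrary: x z rule: forest_induct)
  case (Cons a f g)
  obtain i p q where [simp]: "z = i # p" "x = i # q" and "prefix p q"
    using Cons.prems by (cases z; cases x) auto
  then show ?case
    using Cons.prems Cons.IH(1)[of q p] Cons.IH(2)[of "(i - 1) # q" "(i - 1) # p"]
    by (auto simp: nodes_Cons split: nat.splits)
qed simp

text \<open>The ancestors of a node are the nonempty prefixes of its address. The empty longest
  common prefix, which occurs for nodes of different trees, is what makes the closest common
  ancestor a partial operation.\<close>

lemma is_cca_iff:
  assumes "x \<in> nodes t"
  shows "is_cca t x y z \<longleftrightarrow> z \<noteq> [] \<and> z = lcp x y"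
proof -
  have "lcp x y \<in> nodes t" if "lcp x y \<noteq> []"
    using nodes_prefix_closed[OF assms longest_common_prefix_prefix1 that] .
  then show ?thesis
    unfolding is_cca_def using Nil_notin_nodes
    by (metis nodes_prefix_closed[OF assms] prefix_Nil prefix_lcp_iff prefix_order.antisym
        prefix_order.order_refl)
qed

lemma before_simps [simp]:
  "before [] y \<longleftrightarrow> y \<noteq> []" "\<not> before x []"
  "before (i # x) (j # y) \<longleftrightarrow> i < j \<or> i = j \<and> before x y"
  by (auto simp: before_def neq_Nil_conv)

lemma before_irrefl [simp]: "\<not> before x x"
  by (induction x) auto

lemma before_linear: "before x y \<or> x = y \<or> before y x"
  by (induction x y rule: list_induct2') auto

text \<open>
  Sending the empty address, which is not a node, to itself turns preservation of the closest
  common ancestor, including undefinedness, into one equation.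
\<close>

definition lcp_embedding :: "'a forest \<Rightarrow> 'a forest \<Rightarrow> (nat list \<Rightarrow> nat list) \<Rightarrow> bool" where
  "lcp_embedding s t \<phi> \<longleftrightarrow> \<phi> [] = [] \<and>
     (\<forall>x\<in>nodes s. \<phi> x \<in> nodes t \<and> label t (\<phi> x) = label s x) \<and>
     (\<forall>x\<in>nodes s. \<forall>y\<in>nodes s. (before x y \<longrightarrow> before (\<phi> x) (\<phi> y)) \<and>
        \<phi> (lcp x y) = lcp (\<phi> x) (\<phi> y))"

lemma cca_piece_iff: "cca_piece s t \<longleftrightarrow> (\<exists>\<phi>. lcp_embedding s t \<phi>)"
proof
  assume "cca_piece s t"
  then obtain \<phi> where \<phi>: "cca_embedding s t \<phi>"
    unfolding cca_piece_def by blast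
  have "(\<phi>([] := [])) (lcp x y) = lcp (\<phi> x) (\<phi> y)" if "x \<in> nodes s" "y \<in> nodes s" for x y
  proof -
    have "\<phi> x \<in> nodes t"
      using \<phi> that unfolding cca_embedding_def by blast
    moreover have "{z. is_cca t (\<phi> x) (\<phi> y) z} = \<phi> ` {z. is_cca s x y z}"
      using \<phi> that unfolding cca_embedding_def by blast
    ultimately have eq: "{z. z \<noteq> [] \<and> z = lcp (\<phi> x) (\<phi> y)} = \<phi> ` {z. z \<noteq> [] \<and> z = lcp x y}"
      using that by (simp add: is_cca_iff)
    show ?thesis
    proof (cases "lcp x y = []")
      case True
      then show ?thesis
        using eq by auto
    next
      case False
      then have "{z. z \<noteq> [] \<and> z = lcp x y} = {lcp x y}"
        by auto
      then have "\<phi> (lcp x y) \<in> {z. z \<noteq> [] \<and> z = lcp (\<phi> x) (\<phi> y)}"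
        using eq by simp
      then show ?thesis
        using False by simp
    qed
  qed
  then have "lcp_embedding s t (\<phi>([] := []))"
    using \<phi> unfolding lcp_embedding_def cca_embedding_def
    by (auto simp del: fun_upd_apply simp add: fun_upd_same fun_upd_other nodes_ne image_subset_iff)
  then show "\<exists>\<phi>. lcp_embedding s t \<phi>"
    by blast
next
  assume "\<exists>\<phi>. lcp_embedding s t \<phi>"
  then obtain \<phi> where \<phi>: "lcp_embedding s t \<phi>"
    by (rule exE)
  have ne: "\<phi> x \<noteq> []" if "x \<in> nodes s" for x
    using \<phi> that unfolding lcp_embedding_def by (metis Nil_notin_nodes)
  \<comment> \<open>Any two distinct nodes are comparable in the depth-first order; since the order
    is irreflexive and preserved, their images differ.\<close>
  have "inj_on \<phi> (nodes s)"
    using \<phi> before_linear unfolding lcp_embedding_def by (metis before_irrefl inj_onI)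
  moreover have "{z. is_cca t (\<phi> x) (\<phi> y) z} = \<phi> ` {z. is_cca s x y z}"
    if "x \<in> nodes s" "y \<in> nodes s" for x y
  proof -
    have "\<phi> x \<in> nodes t" and l: "lcp (\<phi> x) (\<phi> y) = \<phi> (lcp x y)" and "\<phi> [] = []"
      using \<phi> that unfolding lcp_embedding_def by auto
    moreover have "\<phi> (lcp x y) \<noteq> []" if "lcp x y \<noteq> []"
      using nodes_prefix_closed[OF \<open>x \<in> nodes s\<close> longest_common_prefix_prefix1 that] ne by blast
    ultimately show ?thesis
      using that by (auto simp: is_cca_iff)
  qed
  ultimately have "cca_embedding s t \<phi>"
    using \<phi> unfolding cca_embedding_def lcp_embedding_def by blast
  then show "cca_piece s t"
    unfolding cca_piece_def by blast
qed

lemma lcp_embedding_trans: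
  "lcp_embedding s t \<phi> \<Longrightarrow> lcp_embedding t u \<psi> \<Longrightarrow> lcp_embedding s u (\<psi> \<circ> \<phi>)"
  unfolding lcp_embedding_def by auto

lemma cca_piece_trans: "cca_piece s t \<Longrightarrow> cca_piece t u \<Longrightarrow> cca_piece s u"
  unfolding cca_piece_iff using lcp_embedding_trans by blast

lemma cca_piece_refl: "cca_piece t t"
  unfolding cca_piece_iff by (intro exI[of _ id]) (auto simp: lcp_embedding_def)

section \<open>Building node maps along the rules of \<open>emb\<close>\<close>

fun shift :: "nat list \<Rightarrow> nat list" where
  "shift [] = []"
| "shift (i # p) = Suc i # p"

fun unshift :: "nat list \<Rightarrow> nat list" where
  "unshift [] = []"
| "unshift (i # p) = (i - 1) # p"

lemma shift_props [simp]:
  "shift x = [] \<longleftrightarrow> x = []" "unshift (shift x) = x" "before (shift x) (shift y) \<longleftrightarrow> before x y"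
  "lcp (shift x) (shift y) = shift (lcp x y)" "shift x \<in> nodes (u # g) \<longleftrightarrow> x \<in> nodes g"
  "lcp (0 # p) (shift x) = []" "lcp (shift x) (0 # p) = []"
  "before (0 # p) (shift x) \<longleftrightarrow> x \<noteq> []" "before (shift x) (0 # p) \<longleftrightarrow> x = []"
  by (cases x; cases y; auto simp: nodes_Cons)+

lemma label_shift [simp]: "x \<noteq> [] \<Longrightarrow> label (u # g) (shift x) = label g x"
  by (cases x) (auto simp: label_Cons)

lemma nodes_Cons_cases:
  assumes "x \<in> nodes (u # g)"
  obtains (left) p where "x = 0 # p" "0 # p \<in> nodes [u]"
  | (right) y where "x = shift y" "y \<in> nodes g"
proof (cases x)
  case (Cons i p)
  then show ?thesis
    using assms left right[of "(i - 1) # p"] by (cases i) (auto simp: nodes_Cons)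
qed (use assms in auto)

lemma left_simps [simp]:
  "0 # p \<in> nodes (u # g) \<longleftrightarrow> p = [] \<or> p \<in> nodes (children u)"
  "label (u # g) (0 # p) = (if p = [] then root_label u else label (children u) p)"
  by (auto simp: nodes_Cons label_Cons)

lemma nodes_single: "x \<in> nodes [u] \<longleftrightarrow> (\<exists>p. x = 0 # p \<and> (p = [] \<or> p \<in> nodes (children u)))"
  by (cases x) (auto simp: nodes_Cons split: nat.splits)

lemma lcp_embeddingD:
  assumes "lcp_embedding s t \<phi>"
  shows "\<phi> [] = []" "x \<in> nodes s \<Longrightarrow> \<phi> x \<in> nodes t" "x \<in> nodes s \<Longrightarrow> label t (\<phi> x) = label s x"
    "x \<in> nodes s \<Longrightarrow> y \<in> nodes s \<Longrightarrow> before x y \<Longrightarrow> before (\<phi> x) (\<phi> y)"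
    "x \<in> nodes s \<Longrightarrow> y \<in> nodes s \<Longrightarrow> \<phi> (lcp x y) = lcp (\<phi> x) (\<phi> y)"
  using assms unfolding lcp_embedding_def by blast+

lemma lcp_embedding_shift: "lcp_embedding g (u # g) shift"
  unfolding lcp_embedding_def by (auto simp: nodes_ne)

text \<open>The two maps act on separate blocks of addresses: images of the first tree start with 0,
  all others with a positive number. Mixed pairs therefore have the empty longest common prefix
  before and after, and keep their order.\<close>

lemma lcp_embedding_Cons:
  assumes \<phi>: "lcp_embedding [u] [v] \<phi>" and \<psi>: "lcp_embedding g g' \<psi>"
  shows "\<exists>\<chi>. lcp_embedding (u # g) (v # g') \<chi>"
proof -
  define \<chi> where "\<chi> x = (case x of [] \<Rightarrow> [] | i # p \<Rightarrow>
    (case i of 0 \<Rightarrow> \<phi> (0 # p) | Suc j \<Rightarrow> shift (\<psi> (j # p))))" for x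
  have [simp]: "\<chi> [] = []" "\<chi> (0 # p) = \<phi> (0 # p)" "\<chi> (shift x) = shift (\<psi> x)" for p x
    using lcp_embeddingD(1)[OF \<psi>] by (cases x; simp add: \<chi>_def)+
  have l: "\<exists>q. \<phi> (0 # p) = 0 # q \<and> 0 # q \<in> nodes [v]" if "0 # p \<in> nodes [u]" for p
    using lcp_embeddingD(2)[OF \<phi> that] by (metis nodes_single left_simps(1))
  have "lcp_embedding (u # g) (v # g') \<chi>"
    unfolding lcp_embedding_def
  proof (intro conjI ballI impI)
    fix x assume x: "x \<in> nodes (u # g)"
    then have "\<chi> x \<in> nodes (v # g') \<and> label (v # g') (\<chi> x) = label (u # g) x"
    proof (cases rule: nodes_Cons_cases)
      case (left p)
      then show ?thesis
        using l[of p] lcp_embeddingD(3)[OF \<phi> left(2)] by auto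
    next
      case (right y)
      then show ?thesis
        using lcp_embeddingD(2,3)[OF \<psi> right(2)] right
          nodes_ne[OF right(2)] nodes_ne[OF lcp_embeddingD(2)[OF \<psi> right(2)]] by simp
    qed
    then show "\<chi> x \<in> nodes (v # g')" "label (v # g') (\<chi> x) = label (u # g) x"
      by blast+
    fix y assume y: "y \<in> nodes (u # g)"
    show "\<chi> (lcp x y) = lcp (\<chi> x) (\<chi> y)"
    proof (rule nodes_Cons_cases[OF y]; rule nodes_Cons_cases[OF x])
      fix p q assume *: "x = 0 # p" "0 # p \<in> nodes [u]" "y = 0 # q" "0 # q \<in> nodes [u]"
      then show ?thesis
        using lcp_embeddingD(5)[OF \<phi> *(2,4)] by simp
    next
      fix p z assume *: "x = 0 # p" "0 # p \<in> nodes [u]" "y = shift z" "z \<in> nodes g"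
      then show ?thesis
        using l[of p] by auto
    next
      fix p z assume *: "y = 0 # p" "0 # p \<in> nodes [u]" "x = shift z" "z \<in> nodes g"
      then show ?thesis
        using l[of p] by auto
    next
      fix w z assume *: "y = shift w" "w \<in> nodes g" "x = shift z" "z \<in> nodes g"
      then show ?thesis
        using lcp_embeddingD(5)[OF \<psi> *(4,2)] by simp
    qed
    assume "before x y"
    show "before (\<chi> x) (\<chi> y)"
    proof (rule nodes_Cons_cases[OF y]; rule nodes_Cons_cases[OF x])
      fix p q assume *: "x = 0 # p" "0 # p \<in> nodes [u]" "y = 0 # q" "0 # q \<in> nodes [u]"
      then show ?thesis
        using lcp_embeddingD(4)[OF \<phi> *(2,4)] \<open>before x y\<close> by simp
    next
      fix p z assume *: "x = 0 # p" "0 # p \<in> nodes [u]" "y = shift z" "z \<in> nodes g"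
      then show ?thesis
        using l[of p] nodes_ne[OF lcp_embeddingD(2)[OF \<psi> *(4)]] by auto
    next
      fix p z assume *: "y = 0 # p" "0 # p \<in> nodes [u]" "x = shift z" "z \<in> nodes g"
      then show ?thesis
        using \<open>before x y\<close> by (auto simp: nodes_ne)
    next
      fix w z assume *: "y = shift w" "w \<in> nodes g" "x = shift z" "z \<in> nodes g"
      then show ?thesis
        using lcp_embeddingD(4)[OF \<psi> *(4,2)] \<open>before x y\<close> by simp
    qed
  qed simp
  then show ?thesis
    by blast
qed

lemma lcp_embedding_match:
  assumes "lcp_embedding f f' \<phi>"
  shows "lcp_embedding [Node a f] [Node a f'] (\<lambda>x. case x of [] \<Rightarrow> [] | i # p \<Rightarrow> 0 # \<phi> p)"
  using lcp_embeddingD[OF assms] nodes_ne[OF lcp_embeddingD(2)[OF assms]] unfolding lcp_embedding_def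
  by (auto simp: nodes_single nodes_ne)

text \<open>The source has to be a single tree: its nodes have pairwise nonempty longest common
  prefixes. Two trees placed below one node would acquire a closest common ancestor that they
  lacked, which is why the rule \<open>descend\<close> moves one tree only.\<close>

lemma lcp_embedding_descend:
  assumes "lcp_embedding [u] f' \<phi>"
  shows "lcp_embedding [u] [Node b f'] (\<lambda>x. case x of [] \<Rightarrow> [] | i # p \<Rightarrow> 0 # \<phi> x)"
  unfolding lcp_embedding_def
proof (intro conjI ballI impI)
  note D = lcp_embeddingD[OF assms]
  let ?\<chi> = "\<lambda>x. case x of [] \<Rightarrow> [] | i # p \<Rightarrow> 0 # \<phi> x"
  have eq: "?\<chi> x = 0 # \<phi> x" if "x \<in> nodes [u]" for x
    using that by (auto simp: nodes_single)
  fix x assume x: "x \<in> nodes [u]"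
  show "?\<chi> x \<in> nodes [Node b f']" "label [Node b f'] (?\<chi> x) = label [u] x"
    unfolding eq[OF x] using D(2,3)[OF x] nodes_ne by auto
  fix y assume y: "y \<in> nodes [u]"
  obtain p where "lcp x y = 0 # p"
    using x y by (auto simp: nodes_single)
  then show "?\<chi> (lcp x y) = lcp (?\<chi> x) (?\<chi> y)"
    unfolding eq[OF x] eq[OF y] using D(5)[OF x y] by simp
  show "before (?\<chi> x) (?\<chi> y)" if "before x y"
    unfolding eq[OF x] eq[OF y] using D(4)[OF x y that] by simp
qed simp

lemma emb_imp_cca_piece: "emb s t \<Longrightarrow> cca_piece s t"
proof (induction rule: emb.induct)
  case (Nil t)
  then show ?case
    unfolding cca_piece_iff lcp_embedding_def by (intro exI[of _ id]) simp
next
  case (skip s t v)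
  then obtain \<phi> where "lcp_embedding s t \<phi>"
    by (auto simp: cca_piece_iff)
  from lcp_embedding_trans[OF this lcp_embedding_shift] show ?case
    by (auto simp: cca_piece_iff)
next
  case (match f f' g g' a)
  then obtain \<phi> \<psi> where "lcp_embedding f f' \<phi>" "lcp_embedding g g' \<psi>"
    by (auto simp: cca_piece_iff)
  from lcp_embedding_Cons[OF lcp_embedding_match[OF this(1)] this(2)] show ?case
    by (simp add: cca_piece_iff)
next
  case (descend u f' g g' b)
  then obtain \<phi> \<psi> where "lcp_embedding [u] f' \<phi>" "lcp_embedding g g' \<psi>"
    by (auto simp: cca_piece_iff)
  from lcp_embedding_Cons[OF lcp_embedding_descend[OF this(1)] this(2)] show ?case
    by (simp add: cca_piece_iff)
qed

section \<open>Recovering the rules of \<open>emb\<close> from a node map\<close>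

lemma lcp_embedding_unshift:
  assumes \<phi>: "lcp_embedding s (u # g) \<phi>" and sh: "\<And>x. x \<in> nodes s \<Longrightarrow> \<exists>z. \<phi> x = shift z"
  shows "lcp_embedding s g (unshift \<circ> \<phi>)"
proof -
  obtain \<psi> where \<psi>: "\<And>x. x \<in> nodes s \<Longrightarrow> \<phi> x = shift (\<psi> x)"
    using sh by metis
  note D = lcp_embeddingD[OF \<phi>]
  show ?thesis
    unfolding lcp_embedding_def
  proof (intro conjI ballI impI)
    fix x assume x: "x \<in> nodes s"
    show n: "(unshift \<circ> \<phi>) x \<in> nodes g"
      using D(2)[OF x] \<psi>[OF x] by simp
    show "label g ((unshift \<circ> \<phi>) x) = label s x"
      using D(3)[OF x] \<psi>[OF x] n nodes_ne[OF n] by simp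
    fix y assume y: "y \<in> nodes s"
    show "(unshift \<circ> \<phi>) (lcp x y) = lcp ((unshift \<circ> \<phi>) x) ((unshift \<circ> \<phi>) y)"
      using D(5)[OF x y] \<psi>[OF x] \<psi>[OF y] by simp
    show "before ((unshift \<circ> \<phi>) x) ((unshift \<circ> \<phi>) y)" if "before x y"
      using D(4)[OF x y that] \<psi>[OF x] \<psi>[OF y] by simp
  qed (simp add: D(1))
qed

text \<open>The root is an ancestor of every node of \<open>[u]\<close>, so its image is a prefix of
  every image and the whole tree goes into one subtree. The cases \<open>q = []\<close> and
  \<open>q\<close> nonempty correspond to the rules \<open>match\<close> and
  \<open>descend\<close>.\<close>

lemma lcp_embedding_below:
  assumes \<phi>: "lcp_embedding [u] (Node b f' # g') \<phi>" and root: "\<phi> [0] = 0 # q"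
  shows "\<And>x. x \<in> nodes [u] \<Longrightarrow> \<exists>p. \<phi> x = 0 # q @ p"
    "q = [] \<Longrightarrow> root_label u = b \<and> lcp_embedding (children u) f' (\<lambda>p. tl (\<phi> (0 # p)))"
    "q \<noteq> [] \<Longrightarrow> lcp_embedding [u] f' (tl \<circ> \<phi>)"
proof -
  note D = lcp_embeddingD[OF \<phi>]
  have r: "[0] \<in> nodes [u]"
    by simp
  show *: "\<exists>p. \<phi> x = 0 # q @ p" if "x \<in> nodes [u]" for x
  proof -
    have "lcp [0] x = [0]"
      using that by (auto simp: nodes_single)
    then have "prefix (0 # q) (\<phi> x)"
      using D(5)[OF r that] root by (metis lcp_eq_iff_prefix)
    then show ?thesis
      by (auto simp: prefix_def)
  qed
  show "root_label u = b \<and> lcp_embedding (children u) f' (\<lambda>p. tl (\<phi> (0 # p)))" if q: "q = []"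
  proof -
    have "root_label u = b"
      using D(3)[OF r] root q by simp
    moreover have "lcp_embedding (children u) f' (\<lambda>p. tl (\<phi> (0 # p)))"
      unfolding lcp_embedding_def
    proof (intro conjI ballI impI)
      have below: "\<exists>p. \<phi> (0 # x) = 0 # p \<and> p \<noteq> [] \<and> 0 # x \<in> nodes [u]" if "x \<in> nodes (children u)" for x
        using *[of "0 # x"] D(4)[OF r, of "0 # x"] that root q nodes_ne[OF that] by auto
      fix x assume x: "x \<in> nodes (children u)"
      then obtain p where p: "\<phi> (0 # x) = 0 # p" "p \<noteq> []" "0 # x \<in> nodes [u]"
        using below by blast
      show "tl (\<phi> (0 # x)) \<in> nodes f'"
        using D(2)[OF p(3)] p by simp
      show "label f' (tl (\<phi> (0 # x))) = label (children u) x"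
        using D(3)[OF p(3)] p x nodes_ne by auto
      fix y assume y: "y \<in> nodes (children u)"
      then obtain p' where p': "\<phi> (0 # y) = 0 # p'" "p' \<noteq> []" "0 # y \<in> nodes [u]"
        using below by blast
      show "tl (\<phi> (0 # lcp x y)) = lcp (tl (\<phi> (0 # x))) (tl (\<phi> (0 # y)))"
        using D(5)[OF p(3) p'(3)] p p' by simp
      show "before (tl (\<phi> (0 # x))) (tl (\<phi> (0 # y)))" if "before x y"
        using D(4)[OF p(3) p'(3)] p p' that by simp
    qed (simp add: root q)
    ultimately show ?thesis ..
  qed
  show "lcp_embedding [u] f' (tl \<circ> \<phi>)" if q: "q \<noteq> []"
    unfolding lcp_embedding_def
  proof (intro conjI ballI impI)
    fix x assume x: "x \<in> nodes [u]"
    then obtain p where p: "\<phi> x = 0 # p" "p \<noteq> []"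
      using * q by fastforce
    show "(tl \<circ> \<phi>) x \<in> nodes f'"
      using D(2)[OF x] p by simp
    show "label f' ((tl \<circ> \<phi>) x) = label [u] x"
      using D(3)[OF x] p by simp
    fix y assume y: "y \<in> nodes [u]"
    then obtain p' where p': "\<phi> y = 0 # p'"
      using * by auto
    show "(tl \<circ> \<phi>) (lcp x y) = lcp ((tl \<circ> \<phi>) x) ((tl \<circ> \<phi>) y)"
      using D(5)[OF x y] p p' by simp
    show "before ((tl \<circ> \<phi>) x) ((tl \<circ> \<phi>) y)" if "before x y"
      using D(4)[OF x y that] p p' by simp
  qed (simp add: D(1))
qed

text \<open>The image of the first root of \<open>s\<close> selects the rule: \<open>skip\<close> if
  it lies beyond the first tree of the target, \<open>match\<close> if it is the root of that tree,
  and \<open>descend\<close> if it lies properly inside.\<close>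

lemma lcp_embedding_imp_emb: "lcp_embedding s t \<phi> \<Longrightarrow> emb s t"
proof (induction t arbitrary: s \<phi> rule: forest_induct)
  case Nil
  then have "nodes s = {}"
    using lcp_embeddingD(2)[OF Nil] by auto
  then show ?case
    by (cases s; use left_simps(1)[of "[]"] in \<open>fastforce simp: emb.Nil simp del: left_simps\<close>)
next
  case (Cons b f' g')
  note D = lcp_embeddingD[OF Cons.prems]
  show ?case
  proof (cases s)
    case Nil
    then show ?thesis
      by (simp add: emb.Nil)
  next
    case s: (Cons u g)
    have root: "[0] \<in> nodes s"
      by (simp add: s)
    from D(2)[OF root] show ?thesis
    proof (cases rule: nodes_Cons_cases)
      case (right y)
      \<comment> \<open>Every other node comes after the first root, so its image comes after
        \<open>shift y\<close> and cannot lie in the first tree.\<close>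
      have "\<exists>z. \<phi> x = shift z" if x: "x \<in> nodes s" for x
      proof (cases "x = [0]")
        case False
        then have "before [0] x"
          using x by (cases x) (auto simp: neq_Nil_conv)
        then have "before (shift y) (\<phi> x)"
          using D(4)[OF root x] right by simp
        with D(2)[OF x] show ?thesis
          by (cases rule: nodes_Cons_cases) (use nodes_ne[OF right(2)] in auto)
      qed (use right in auto)
      then show ?thesis
        using emb.skip[OF Cons.IH(2)[OF lcp_embedding_unshift[OF Cons.prems]]] by blast
    next
      case (left q)
      have "lcp_embedding [u] (u # g) id"
        unfolding lcp_embedding_def by (auto simp: nodes_single)
      then have u: "lcp_embedding [u] (Node b f' # g') \<phi>"
        using lcp_embedding_trans Cons.prems s by fastforce
      \<comment> \<open>Nodes of the other trees have no common ancestor with the first root, while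
        every node of the first target tree shares the ancestor \<open>[0]\<close> with the image
        \<open>0 # q\<close>. The other trees are therefore mapped beyond the first target
        tree.\<close>
      have sh: "\<exists>z. \<phi> (shift x) = shift z" if x: "x \<in> nodes g" for x
      proof -
        have x': "shift x \<in> nodes s"
          using x s by simp
        have "lcp (\<phi> [0]) (\<phi> (shift x)) = []"
          using D(5)[OF root x'] D(1) by simp
        with D(2)[OF x'] show ?thesis
          by (cases rule: nodes_Cons_cases) (use left(1) in auto)
      qed
      have g: "emb g g'"
        using Cons.IH(2)[OF lcp_embedding_unshift[OF lcp_embedding_trans[OF lcp_embedding_shift]]]
          Cons.prems sh s by (metis comp_apply)
      show ?thesis
      proof (cases "q = []")
        case True
        have "emb (children u) f'" "root_label u = b"
          using lcp_embedding_below(2)[OF u left(1) True] Cons.IH(1) by blast+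
        then show ?thesis
          using emb.match[OF _ g, of "children u" f' b] s by (cases u) simp
      next
        case False
        then show ?thesis
          using emb.descend[OF Cons.IH(1)[OF lcp_embedding_below(3)[OF u left(1)]] g] s by simp
      qed
    qed
  qed
qed

lemma emb_iff_cca_piece: "emb s t \<longleftrightarrow> cca_piece s t"
  using emb_imp_cca_piece lcp_embedding_imp_emb unfolding cca_piece_iff by blast

lemma emb_refl: "emb t t"
  by (simp add: emb_iff_cca_piece cca_piece_refl)

lemma emb_trans: "emb s t \<Longrightarrow> emb t u \<Longrightarrow> emb s u"
  unfolding emb_iff_cca_piece by (rule cca_piece_trans)

lemma card_nodes: "finite (nodes t) \<and> card (nodes t) = fsize t"
proof (induction t rule: forest_induct)
  case (Cons a f g)
  have n: "nodes (Node a f # g) = insert [0] (Cons 0 ` nodes f \<union> shift ` nodes g)"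
  proof (intro equalityI subsetI)
    fix x assume "x \<in> nodes (Node a f # g)"
    then show "x \<in> insert [0] (Cons 0 ` nodes f \<union> shift ` nodes g)"
      by (cases rule: nodes_Cons_cases) auto
  qed auto
  have "inj shift"
    using shift_props(2) by (metis injI)
  moreover have "shift x \<noteq> 0 # p" for x p
    by (cases x) auto
  ultimately have "card (Cons 0 ` nodes f \<union> shift ` nodes g) = fsize f + fsize g"
    using Cons by (subst card_Un_disjoint) (auto simp: card_image inj_on_def dest: sym)
  moreover have "[0] \<notin> Cons 0 ` nodes f \<union> shift ` nodes g"
    using \<open>\<And>x p. shift x \<noteq> 0 # p\<close> by (metis Nil_notin_nodes Un_iff imageE list.inject)
  ultimately show ?case
    unfolding n using Cons by simp
qed simp

lemma Nil_in_forests [simp]: "[] \<in> forests A"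
  by (simp add: forests_def)

lemma Node_in_forests [simp]:
  "Node a f # g \<in> forests A \<longleftrightarrow> a \<in> A \<and> f \<in> forests A \<and> g \<in> forests A"
  by (auto simp: forests_def)

lemma emb_labels: "emb s t \<Longrightarrow> t \<in> forests A \<Longrightarrow> s \<in> forests A"
proof (induction rule: emb.induct)
  case (skip s t v)
  then show ?case
    by (cases v) simp
next
  case (descend u f' g g' b)
  then show ?case
    by (cases u) simp
qed simp_all

section \<open>Kruskal's theorem\<close>

text \<open>The sequence property of well-quasi-orders. Reflexivity and transitivity are kept apart
  and assumed where they are used.\<close>

definition good_on :: "('a \<Rightarrow> 'a \<Rightarrow> bool) \<Rightarrow> 'a set \<Rightarrow> bool" where
  "good_on P S \<longleftrightarrow> (\<forall>f :: nat \<Rightarrow> 'a. (\<forall>i. f i \<in> S) \<longrightarrow> (\<exists>i j. i < j \<and> P (f i) (f j)))"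

lemma good_onD:
  fixes f :: "nat \<Rightarrow> 'a"
  shows "good_on P S \<Longrightarrow> (\<And>i. f i \<in> S) \<Longrightarrow> \<exists>i j. i < j \<and> P (f i) (f j)"
  by (simp add: good_on_def)

text \<open>Infinitely many indices without a later partner would form a sequence without a good
  pair. Past the last of these indices one can step to a larger entry forever, and transitivity
  relates all the entries visited.\<close>

lemma good_on_homogeneous:
  fixes f :: "nat \<Rightarrow> 'a"
  assumes good: "good_on P S" and f: "\<And>i. f i \<in> S"
    and trans: "\<And>x y z. x \<in> S \<Longrightarrow> y \<in> S \<Longrightarrow> z \<in> S \<Longrightarrow> P x y \<Longrightarrow> P y z \<Longrightarrow> P x z"
  shows "\<exists>\<phi> :: nat \<Rightarrow> nat. strict_mono \<phi> \<and> (\<forall>i j. i < j \<longrightarrow> P (f (\<phi> i)) (f (\<phi> j)))"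
proof -
  define T where "T i \<longleftrightarrow> (\<forall>j>i. \<not> P (f i) (f j))" for i
  have "finite {i. T i}"
  proof (rule ccontr)
    assume inf: "infinite {i. T i}"
    define e where "e = Infinite_Set.enumerate {i. T i}"
    have "T (e n)" "m < n \<Longrightarrow> e m < e n" for m n
      using enumerate_in_set[OF inf] enumerate_mono[OF _ inf] by (auto simp: e_def)
    then show False
      using good_onD[OF good, of "\<lambda>n. f (e n)"] f unfolding T_def by blast
  qed
  then obtain b where b: "\<And>i. T i \<Longrightarrow> i < b"
    unfolding finite_nat_set_iff_bounded by blast
  then have "\<forall>i\<ge>b. \<exists>j>i. P (f i) (f j)"
    unfolding T_def by (meson not_less)
  then obtain n where n: "\<And>i. i \<ge> b \<Longrightarrow> i < n i \<and> P (f i) (f (n i))"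
    by metis
  define \<phi> where "\<phi> k = (n ^^ k) b" for k
  have ge: "\<phi> k \<ge> b" for k
    by (induction k) (use n in \<open>auto simp: \<phi>_def intro: order.trans less_imp_le\<close>)
  have step: "\<phi> k < \<phi> (Suc k)" "P (f (\<phi> k)) (f (\<phi> (Suc k)))" for k
    using n[OF ge[of k]] by (auto simp: \<phi>_def)
  have "P (f (\<phi> i)) (f (\<phi> (Suc (i + d))))" for i d
  proof (induction d)
    case (Suc d)
    then show ?case
      using step(2)[of "Suc (i + d)"] trans[OF f f f] by auto
  qed (use step in auto)
  then have "P (f (\<phi> i)) (f (\<phi> j))" if "i < j" for i j
    using less_imp_Suc_add[OF that] by auto
  then show ?thesis
    using step(1) by (intro exI[of _ \<phi>]) (simp add: strict_mono_Suc_iff)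
qed

text \<open>
  Nash-Williams' argument: the entries of the bad sequence are chosen one after the other, each
  of minimal size.
\<close>

lemma minimal_bad_sequence:
  fixes sz :: "'a \<Rightarrow> nat"
  assumes bad: "\<not> good_on P S"
    and trans: "\<And>x y z. P x y \<Longrightarrow> P y z \<Longrightarrow> P x z"
    and part: "\<And>p x. part p x \<Longrightarrow> x \<in> S \<Longrightarrow> p \<in> S \<and> P p x \<and> sz p < sz x"
  shows "\<exists>t :: nat \<Rightarrow> 'a. (\<forall>i. t i \<in> S) \<and> (\<forall>i j. i < j \<longrightarrow> \<not> P (t i) (t j)) \<and> good_on P {p. \<exists>i. part p (t i)}"
proof -
  define B where "B f \<longleftrightarrow> (\<forall>i. f i \<in> S) \<and> (\<forall>i j. i < j \<longrightarrow> \<not> P (f i) (f j))" for f :: "nat \<Rightarrow> 'a"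
  define ext where "ext xs x \<longleftrightarrow> (\<exists>f. B f \<and> (\<forall>i<length xs. f i = xs ! i) \<and> f (length xs) = x)" for xs x
  \<comment> \<open>Minimality ranges over all bad sequences that continue the entries already
    fixed; this is what \<open>min\<close> records below.\<close>
  define pick where "pick xs = (ARG_MIN sz x. ext xs x)" for xs
  define pre where "pre n = rec_nat [] (\<lambda>_ xs. xs @ [pick xs]) n" for n
  define t where "t n = pick (pre n)" for n
  have pre_Suc: "pre (Suc n) = pre n @ [t n]" and len: "length (pre n) = n" for n
    by (auto simp: pre_def t_def) (induction n; auto)
  have nth: "pre n ! i = t i" if "i < n" for i n
    using that by (induction n) (auto simp: pre_Suc len nth_append less_Suc_eq)
  have pick: "ext xs (pick xs)" "ext xs x \<Longrightarrow> sz (pick xs) \<le> sz x" if "ext xs y" for xs x y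
    using arg_min_natI[of "ext xs", OF that] arg_min_nat_le[of "ext xs" x sz] by (auto simp: pick_def)
  have ext: "ext (pre n) (t n)" for n
  proof (induction n)
    case 0
    obtain f where "B f"
      using bad unfolding good_on_def B_def by blast
    then have "ext [] (f 0)"
      unfolding ext_def by auto
    then show ?case
      using pick by (simp add: pre_def t_def)
  next
    case (Suc n)
    then obtain f where f: "B f" "\<forall>i<n. f i = t i" "f n = t n"
      by (auto simp: ext_def len nth)
    then have "ext (pre (Suc n)) (f (Suc n))"
      unfolding ext_def by (intro exI[of _ f]) (auto simp: len nth less_Suc_eq)
    then show ?case
      unfolding t_def[of "Suc n"] by (rule pick)
  qed
  have seq: "\<exists>f. B f \<and> (\<forall>i\<le>n. f i = t i)" for n
    using ext[of n] by (auto simp: ext_def len nth le_less)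
  have t: "t i \<in> S" for i
    using seq[of i] unfolding B_def by (metis order_refl)
  have bt: "\<not> P (t i) (t j)" if "i < j" for i j
    using seq[of j] that unfolding B_def by (metis less_imp_le order_refl)
  have min: "sz (t n) \<le> sz (f n)" if "B f" "\<forall>i<n. f i = t i" for f n
    unfolding t_def by (rule pick(2)[OF ext]) (use that in \<open>auto simp: ext_def len nth\<close>)
  have "good_on P {p. \<exists>i. part p (t i)}"
    unfolding good_on_def
  proof (intro allI impI, rule ccontr)
    fix h :: "nat \<Rightarrow> 'a" assume "\<forall>n. h n \<in> {p. \<exists>i. part p (t i)}"
    then have "\<forall>n. \<exists>i. part (h n) (t i)"
      by auto
    then obtain k where k: "\<And>n. part (h n) (t (k n))"
      by metis
    assume h: "\<not> (\<exists>i j. i < j \<and> P (h i) (h j))"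
    \<comment> \<open>Replacing the entries of \<open>t\<close> from position \<open>k m\<close> on
      by \<open>h m\<close>, \<open>h (m + 1)\<close> and so on keeps the sequence bad, but
      \<open>h m\<close> is smaller than \<open>t (k m)\<close>, which was chosen minimal at that
      position.\<close>
    define m where "m = (ARG_MIN k n. True)"
    have m: "k m \<le> k n" for n
      unfolding m_def by (rule arg_min_nat_le) simp
    define g where "g i = (if i < k m then t i else h (m + (i - k m)))" for i
    have hp: "h n \<in> S" "P (h n) (t (k n))" "sz (h n) < sz (t (k n))" for n
      using part[OF k t] by auto
    have "B g"
      unfolding B_def
    proof (intro conjI allI impI notI)
      fix i show "g i \<in> S"
        by (simp add: g_def t hp)
    next
      fix i j :: nat assume ij: "i < j" and P: "P (g i) (g j)"
      consider "j < k m" | "i < k m" "k m \<le> j" | "k m \<le> i"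
        by linarith
      then show False
      proof cases
        case 1
        with P ij bt show False by (simp add: g_def)
      next
        case 2
        let ?n = "m + (j - k m)"
        \<comment> \<open>The part \<open>h ?n\<close> lies below \<open>t (k ?n)\<close>. By the
          choice of \<open>m\<close>, also \<open>i < k m\<close> and \<open>k m\<close> is at most
          \<open>k ?n\<close>, so this contradicts the badness of \<open>t\<close>.\<close>
        have "P (t i) (t (k ?n))"
          by (rule trans[OF _ hp(2)]) (use P 2 in \<open>simp add: g_def\<close>)
        then show False
          using bt[of i "k ?n"] 2 m[of ?n] by auto
      next
        case 3
        have "m + (i - k m) < m + (j - k m)"
          using 3 ij by linarith
        then show False
          using P h 3 ij by (auto simp: g_def)
      qed
    qed
    moreover have "\<forall>i<k m. g i = t i"
      by (simp add: g_def)
    ultimately have "sz (t (k m)) \<le> sz (g (k m))"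
      by (rule min)
    then show False
      using hp(3)[of m] by (simp add: g_def)
  qed
  then show ?thesis
    using t bt by blast
qed

text \<open>In a minimal bad sequence of lists the tails are good. Along a subsequence with
  ascending heads, a good pair of tails is a good pair of lists.\<close>

lemma higman:
  assumes good: "good_on P S"
    and refl: "\<And>x. P x x" and trans: "\<And>x y z. P x y \<Longrightarrow> P y z \<Longrightarrow> P x z"
  shows "good_on (list_emb P) (lists S)"
proof (rule ccontr)
  assume bad: "\<not> ?thesis"
  have "\<exists>t :: nat \<Rightarrow> 'a list. (\<forall>i. t i \<in> lists S) \<and> (\<forall>i j. i < j \<longrightarrow> \<not> list_emb P (t i) (t j)) \<and>
      good_on (list_emb P) {p. \<exists>i. t i \<noteq> [] \<and> p = tl (t i)}"
  proof (rule minimal_bad_sequence[OF bad, where sz = length])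
    show "p \<in> lists S \<and> list_emb P p x \<and> length p < length x"
      if "x \<noteq> [] \<and> p = tl x" "x \<in> lists S" for p x
      using that by (cases x) (auto intro: list_emb_refl refl)
    show "list_emb P xs zs" if "list_emb P xs ys" "list_emb P ys zs" for xs ys zs
      using list_emb_trans[OF _ that] trans by blast
  qed
  then obtain t :: "nat \<Rightarrow> 'a list" where t: "\<And>i. t i \<in> lists S" "\<And>i j. i < j \<Longrightarrow> \<not> list_emb P (t i) (t j)"
    and g: "good_on (list_emb P) {p. \<exists>i. t i \<noteq> [] \<and> p = tl (t i)}"
    by blast
  have ne: "t i \<noteq> []" for i
    using t(2)[of i "Suc i"] by auto
  then have hd: "hd (t i) \<in> S" "t i = hd (t i) # tl (t i)" for i
    using t(1)[of i] by (cases "t i"; fastforce)+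
  have "\<exists>\<phi> :: nat \<Rightarrow> nat. strict_mono \<phi> \<and> (\<forall>i j. i < j \<longrightarrow> P (hd (t (\<phi> i))) (hd (t (\<phi> j))))"
    by (rule good_on_homogeneous[OF good]) (fact hd(1), erule (1) trans)
  then obtain \<phi> :: "nat \<Rightarrow> nat" where \<phi>: "strict_mono \<phi>"
    "\<And>i j. i < j \<Longrightarrow> P (hd (t (\<phi> i))) (hd (t (\<phi> j)))"
    by blast
  obtain i j where "i < j" "list_emb P (tl (t (\<phi> i))) (tl (t (\<phi> j)))"
    using good_onD[OF g, of "\<lambda>i. tl (t (\<phi> i))"] ne by blast
  then have "list_emb P (t (\<phi> i)) (t (\<phi> j))"
    using \<phi>(2) hd(2) by (metis list_emb_Cons2)
  moreover have "\<phi> i < \<phi> j"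
    using \<phi>(1) \<open>i < j\<close> by (auto dest: strict_monoD)
  ultimately show False
    using t(2) by blast
qed

lemma emb_Cons: "emb [u] [v] \<Longrightarrow> emb g g' \<Longrightarrow> emb (u # g) (v # g')"
  unfolding emb_iff_cca_piece cca_piece_iff using lcp_embedding_Cons by (elim exE)

lemma list_emb_imp_emb: "list_emb (\<lambda>u v. emb [u] [v]) s t \<Longrightarrow> emb s t"
  by (induction rule: list_emb.induct) (auto intro: emb.intros emb_Cons)

lemma emb_member: "u \<in> set f \<Longrightarrow> emb [u] f"
proof (induction f)
  case (Cons v f)
  then show ?case
    using emb_Cons[OF emb_refl emb.Nil, of v f] emb.skip by (cases "u = v") auto
qed simp

lemma fsize_member: "u \<in> set f \<Longrightarrow> fsize [u] \<le> fsize f"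
proof (induction f)
  case (Cons v f)
  then show ?case
    by (cases u; cases v) auto
qed simp

lemma good_on_mono:
  assumes "good_on P S" "\<And>x y. P x y \<Longrightarrow> Q x y"
  shows "good_on Q S"
  unfolding good_on_def
proof (intro allI impI)
  fix f :: "nat \<Rightarrow> 'a" assume "\<forall>i. f i \<in> S"
  then show "\<exists>i j. i < j \<and> Q (f i) (f j)"
    using good_onD[OF assms(1), of f] assms(2) by blast
qed

lemma good_on_eq: "finite A \<Longrightarrow> good_on (=) A"
  unfolding good_on_def
proof (intro allI impI)
  fix f :: "nat \<Rightarrow> 'a" assume "finite A" "\<forall>i. f i \<in> A"
  then have "finite (range f)"
    by (auto intro: finite_subset[of "range f" A])
  then have "\<not> inj f"
    using finite_imageD by auto
  then obtain i j where "i \<noteq> j" "f i = f j"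
    by (auto simp: inj_def)
  then show "\<exists>i j. i < j \<and> f i = f j"
    by (cases i j rule: linorder_cases) (auto intro: exI[of _ i] exI[of _ j] sym)
qed

text \<open>The trees come first: in a minimal bad sequence the children form a good set, hence by
  \<open>higman\<close> so do lists of children. Finiteness of the alphabet gives a subsequence with
  constant root labels, along which a good pair of lists of children is a good pair of trees. A
  second use of \<open>higman\<close> passes from trees to forests.\<close>

theorem kruskal:
  assumes "finite A"
  shows "good_on emb (forests A)"
proof -
  define T where "T = {u. set_tree u \<subseteq> A}"
  let ?P = "\<lambda>u v :: 'a tree. emb [u] [v]"
  have "good_on ?P T"
  proof (rule ccontr)
    assume bad: "\<not> good_on ?P T"
    have "\<exists>t :: nat \<Rightarrow> 'a tree. (\<forall>i. t i \<in> T) \<and> (\<forall>i j. i < j \<longrightarrow> \<not> emb [t i] [t j]) \<and>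
        good_on ?P {p. \<exists>i. p \<in> set (children (t i))}"
    proof (rule minimal_bad_sequence[OF bad, where sz = "\<lambda>u. fsize [u]"])
      show "p \<in> T \<and> emb [p] [x] \<and> fsize [p] < fsize [x]"
        if "p \<in> set (children x)" "x \<in> T" for p x
        using that fsize_member[of p "children x"] emb.descend[OF emb_member emb.Nil]
        by (cases x) (fastforce simp: T_def simp del: fsize.simps(1))
    qed (rule emb_trans)
    then obtain t :: "nat \<Rightarrow> 'a tree" where t: "\<And>i. t i \<in> T" "\<And>i j. i < j \<Longrightarrow> \<not> emb [t i] [t j]"
      and g: "good_on ?P {p. \<exists>i. p \<in> set (children (t i))}"
      by blast
    have "\<exists>\<phi> :: nat \<Rightarrow> nat. strict_mono \<phi> \<and>
        (\<forall>i j. i < j \<longrightarrow> root_label (t (\<phi> i)) = root_label (t (\<phi> j)))"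
    proof (rule good_on_homogeneous[OF good_on_eq[OF assms]])
      show "root_label (t i) \<in> A" for i
        using t(1)[of i] by (cases "t i") (auto simp: T_def)
    qed simp
    then obtain \<phi> :: "nat \<Rightarrow> nat" where \<phi>: "strict_mono \<phi>"
      "\<And>i j. i < j \<Longrightarrow> root_label (t (\<phi> i)) = root_label (t (\<phi> j))"
      by blast
    have "good_on (list_emb ?P) (lists {p. \<exists>i. p \<in> set (children (t i))})"
      by (rule higman[OF g]) (auto intro: emb_refl emb_trans)
    then obtain i j where ij: "i < j" "list_emb ?P (children (t (\<phi> i))) (children (t (\<phi> j)))"
      using good_onD[of "list_emb ?P" "lists {p. \<exists>i. p \<in> set (children (t i))}" "\<lambda>i. children (t (\<phi> i))"]
      by auto
    then have "emb [t (\<phi> i)] [t (\<phi> j)]"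
      using \<phi>(2)[OF ij(1)] emb.match[OF list_emb_imp_emb[OF ij(2)] emb.Nil]
      by (metis tree.collapse)
    moreover have "\<phi> i < \<phi> j"
      using \<phi>(1) ij(1) by (auto dest: strict_monoD)
    ultimately show False
      using t(2) by blast
  qed
  then have "good_on (list_emb ?P) (lists T)"
    by (rule higman) (auto intro: emb_refl emb_trans)
  moreover have "forests A = lists T"
    by (auto simp: forests_def T_def)
  ultimately have "good_on (list_emb ?P) (forests A)"
    by simp
  then show ?thesis
    by (rule good_on_mono) (rule list_emb_imp_emb)
qed

section \<open>Finite bases and downward closed sets\<close>

lemma good_on_finite_basis:
  assumes good: "good_on P S" and U: "U \<subseteq> S"
  shows "\<exists>B \<subseteq> U. finite B \<and> (\<forall>t \<in> U. \<exists>b \<in> B. P b t)"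
proof (rule ccontr)
  assume no: "\<not> ?thesis"
  have *: "\<exists>t. t \<in> U \<and> (\<forall>b \<in> B. \<not> P b t)" if "finite B" "B \<subseteq> U" for B
  proof (rule ccontr)
    assume "\<not> ?thesis"
    then have "\<forall>t \<in> U. \<exists>b \<in> B. P b t"
      by simp
    then show False
      using no[unfolded not_ex, THEN spec, of B] that by simp
  qed
  \<comment> \<open>Without a finite basis one can always choose a further element of
    \<open>U\<close> that lies above none of the earlier choices. The resulting sequence has no good
    pair.\<close>
  define c where "c B = (SOME t. t \<in> U \<and> (\<forall>b \<in> B. \<not> P b t))" for B
  have c: "c B \<in> U \<and> (\<forall>b \<in> B. \<not> P b (c B))" if "finite B" "B \<subseteq> U" for B
    unfolding c_def by (rule someI_ex[OF *[OF that]])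
  define pre where "pre n = rec_nat {} (\<lambda>_ B. insert (c B) B) n" for n
  have "finite (pre n) \<and> pre n \<subseteq> U" for n
    by (induction n) (simp_all add: pre_def c)
  then have pre: "finite (pre n)" "pre n \<subseteq> U" for n
    by auto
  have "c (pre i) \<in> pre j" if "i < j" for i j
    using that by (induction j) (auto simp: pre_def less_Suc_eq)
  then show False
    using good_onD[OF good, of "\<lambda>n. c (pre n)"] c[OF pre] U by (meson subsetD)
qed

definition downset :: "'a set \<Rightarrow> 'a forest set \<Rightarrow> bool" where
  "downset A D \<longleftrightarrow> D \<subseteq> forests A \<and> (\<forall>t \<in> D. \<forall>s. emb s t \<longrightarrow> s \<in> D)"

text \<open>Along a descending chain, pick an element lost at each step. A good pair among them puts
  the earlier one below a later one that survived its loss, and downward closure brings the lost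
  element back.\<close>

lemma wf_downset:
  assumes "finite A"
  shows "wf {(D', D). downset A D' \<and> downset A D \<and> D' \<subset> D}"
  unfolding wf_iff_no_infinite_down_chain
proof
  assume "\<exists>E. \<forall>i. (E (Suc i), E i) \<in> {(D', D). downset A D' \<and> downset A D \<and> D' \<subset> D}"
  then obtain E :: "nat \<Rightarrow> 'a forest set"
    where "\<forall>i. (E (Suc i), E i) \<in> {(D', D). downset A D' \<and> downset A D \<and> D' \<subset> D}"
    by (rule exE)
  then have E: "downset A (E i)" "E (Suc i) \<subset> E i" for i
    by simp_all
  then have "\<forall>i. \<exists>t. t \<in> E i - E (Suc i)"
    by blast
  then obtain t where t: "\<And>i. t i \<in> E i" "\<And>i. t i \<notin> E (Suc i)"
    by (metis Diff_iff)
  have "t i \<in> forests A" for i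
    using t(1) E(1) by (auto simp: downset_def)
  then obtain i j where ij: "i < j" "emb (t i) (t j)"
    using good_onD[OF kruskal[OF assms]] by blast
  have "E j \<subseteq> E (Suc i)"
    using lift_Suc_antimono_le[of E "Suc i" j] E(2) ij(1) by auto
  then have "t i \<in> E (Suc i)"
    using t(1)[of j] ij(2) E(1)[of "Suc i"] unfolding downset_def by blast
  then show False
    using t(2) by simp
qed

section \<open>Testability and alternating sets\<close>

definition pieces :: "'a set \<Rightarrow> nat \<Rightarrow> 'a forest \<Rightarrow> 'a forest set" where
  "pieces A n t = {b \<in> forests A. fsize b \<le> n \<and> emb b t}"

lemma finite_forests:
  assumes "finite A"
  shows "finite {t \<in> forests A. fsize t \<le> n}"
proof (induction n)
  case 0
  have "{t \<in> forests A. fsize t \<le> 0} \<subseteq> {[]}"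
    by (auto elim: fsize.elims)
  then show ?case
    using finite_subset by blast
next
  case (Suc n)
  let ?X = "{t \<in> forests A. fsize t \<le> n}"
  have "{t \<in> forests A. fsize t \<le> Suc n} \<subseteq>
      insert [] ((\<lambda>(a, f, g). Node a f # g) ` (A \<times> ?X \<times> ?X))"
  proof
    fix t assume "t \<in> {t \<in> forests A. fsize t \<le> Suc n}"
    then show "t \<in> insert [] ((\<lambda>(a, f, g). Node a f # g) ` (A \<times> ?X \<times> ?X))"
      by (cases t rule: fsize.cases) (auto simp: image_iff)
  qed
  then show ?case
    using Suc assms finite_subset by blast
qed

lemma finite_pieces: "finite A \<Longrightarrow> finite (pieces A n t)"
  by (rule finite_subset[OF _ finite_forests]) (auto simp: pieces_def)

lemma pieces_mono: "emb s t \<Longrightarrow> pieces A n s \<subseteq> pieces A n t"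
  by (auto simp: pieces_def intro: emb_trans)

lemma emb_Cons_iff:
  "emb b (Node a f # g) \<longleftrightarrow> b = [] \<or> emb b g \<or>
    (\<exists>f1 g1. b = Node a f1 # g1 \<and> emb f1 f \<and> emb g1 g) \<or>
    (\<exists>c f1 g1. b = Node c f1 # g1 \<and> emb [Node c f1] f \<and> emb g1 g)"
proof
  assume "emb b (Node a f # g)"
  then show "b = [] \<or> emb b g \<or>
    (\<exists>f1 g1. b = Node a f1 # g1 \<and> emb f1 f \<and> emb g1 g) \<or>
    (\<exists>c f1 g1. b = Node c f1 # g1 \<and> emb [Node c f1] f \<and> emb g1 g)"
    by (cases rule: emb.cases) (auto, metis tree.exhaust)
qed (auto intro: emb.intros)

text \<open>A piece of a composite forest splits into pieces of its parts that are no larger than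
  itself. Equality of small pieces is thus a congruence with finitely many classes, which is what an
  automaton can compute.\<close>

lemma pieces_Cons_mono:
  assumes "pieces A n f \<subseteq> pieces A n f'" "pieces A n g \<subseteq> pieces A n g'"
  shows "pieces A n (Node a f # g) \<subseteq> pieces A n (Node a f' # g')"
proof
  fix b assume "b \<in> pieces A n (Node a f # g)"
  then have b: "b \<in> forests A" "fsize b \<le> n" and "emb b (Node a f # g)"
    by (auto simp: pieces_def)
  have f: "emb c f'" if "emb c f" "c \<in> forests A" "fsize c \<le> n" for c
    using that assms(1) by (auto simp: pieces_def)
  have g: "emb c g'" if "emb c g" "c \<in> forests A" "fsize c \<le> n" for c
    using that assms(2) by (auto simp: pieces_def)
  have "emb b (Node a f' # g')"
    using \<open>emb b (Node a f # g)\<close> b f g by (auto simp: emb_Cons_iff)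
  then show "b \<in> pieces A n (Node a f' # g')"
    using b by (simp add: pieces_def)
qed

lemma cca_pieces_eq: "t \<in> forests A \<Longrightarrow> cca_pieces n t = pieces A n t"
  unfolding cca_pieces_def pieces_def
  by (auto simp: emb_iff_cca_piece[symmetric] card_nodes intro: emb_labels)

lemma testable_iff:
  "cca_piecewise_testable A L \<longleftrightarrow>
    (\<exists>n. \<forall>s \<in> forests A. \<forall>t \<in> forests A. pieces A n s = pieces A n t \<longrightarrow> (s \<in> L \<longleftrightarrow> t \<in> L))"
  (is "_ = (\<exists>n. ?Q n)")
proof -
  have eq: "(\<forall>s \<in> forests A. \<forall>t \<in> forests A. cca_pieces n s = cca_pieces n t \<longrightarrow> (s \<in> L \<longleftrightarrow> t \<in> L)) \<longleftrightarrow> ?Q n" for n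
    by (intro ball_cong refl) (simp only: cca_pieces_eq)
  \<comment> \<open>Testability asks for a positive bound. Any bound may be raised, because the
    pieces up to \<open>n\<close> can be read off those up to \<open>Suc n\<close>.\<close>
  have Suc: "?Q (Suc n)" if n: "?Q n" for n
  proof (intro ballI impI)
    fix s t assume st: "s \<in> forests A" "t \<in> forests A" and "pieces A (Suc n) s = pieces A (Suc n) t"
    moreover have "pieces A n u = {b \<in> pieces A (Suc n) u. fsize b \<le> n}" for u :: "'a forest"
      by (auto simp: pieces_def)
    ultimately have "pieces A n s = pieces A n t"
      by simp
    then show "s \<in> L \<longleftrightarrow> t \<in> L"
      using n st by blast
  qed
  show ?thesis
    unfolding cca_piecewise_testable_def eq
  proof
    assume "\<exists>n>0. ?Q n"
    then show "\<exists>n. ?Q n"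
      by (elim exE conjE) (rule exI)
  next
    assume "\<exists>n. ?Q n"
    then obtain n where "?Q n"
      by (rule exE)
    then show "\<exists>n>0. ?Q n"
      by (intro exI[of _ "Suc n"] conjI zero_less_Suc Suc)
  qed
qed

section \<open>Alternating sets and the failure of testability\<close>

definition alternating :: "'a forest set \<Rightarrow> 'a forest set \<Rightarrow> bool" where
  "alternating L D \<longleftrightarrow>
     (\<forall>t \<in> D. (\<exists>s \<in> D. emb t s \<and> s \<in> L) \<and> (\<exists>s \<in> D. emb t s \<and> s \<notin> L))"

lemma alternating_imp_not_testable:
  assumes "finite A" "D \<subseteq> forests A" "D \<noteq> {}" "alternating L D"
  shows "\<not> cca_piecewise_testable A L"
proof
  assume "cca_piecewise_testable A L"
  then obtain n where n: "\<And>s t. s \<in> forests A \<Longrightarrow> t \<in> forests A \<Longrightarrow> pieces A n s = pieces A n t \<Longrightarrow>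
      s \<in> L \<longleftrightarrow> t \<in> L"
    unfolding testable_iff by blast
  obtain t0 where t0: "t0 \<in> D"
    using assms by blast
  have bound: "\<forall>t. t \<in> D \<longrightarrow> card (pieces A n t) < Suc (card {t \<in> forests A. fsize t \<le> n})"
    by (intro allI impI le_imp_less_Suc card_mono finite_forests assms) (auto simp: pieces_def)
  obtain t where t: "t \<in> D" "\<forall>s. s \<in> D \<longrightarrow> card (pieces A n s) \<le> card (pieces A n t)"
    using ex_has_greatest_nat[of "\<lambda>t. t \<in> D", OF t0 bound] by (elim exE conjE)
  have eq: "pieces A n t = pieces A n s" if "s \<in> D" "emb t s" for s
    by (rule card_seteq[OF finite_pieces pieces_mono]) (use assms that t in auto)
  then show False
  proof -
    obtain s u where s: "s \<in> D" "emb t s" "s \<in> L" and u: "u \<in> D" "emb t u" "u \<notin> L"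
      using assms(4) t(1) unfolding alternating_def by blast
    have "pieces A n s = pieces A n u"
      using eq[OF s(1,2)] eq[OF u(1,2)] by simp
    then show False
      using n[of s u] s u assms(2) by blast
  qed
qed

lemma not_testable_imp_alternating:
  assumes "finite A" "\<not> cca_piecewise_testable A L"
  shows "\<exists>D. downset A D \<and> D \<noteq> {} \<and> alternating L D"
proof (rule ccontr)
  assume no: "\<not> ?thesis"
  have "downset A E \<longrightarrow> (\<exists>n. \<forall>s\<in>E. \<forall>t\<in>E. pieces A n s = pieces A n t \<longrightarrow> (s \<in> L \<longleftrightarrow> t \<in> L))" for E
  proof (induction E rule: wf_induct_rule[OF wf_downset[OF assms(1)]])
    case (1 E)
    show ?case
    proof (cases "downset A E \<and> E \<noteq> {}")
      case True
      then obtain t c where t: "t \<in> E" "\<And>s. s \<in> E \<Longrightarrow> emb t s \<Longrightarrow> s \<in> L \<longleftrightarrow> c"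
        using no unfolding alternating_def by metis
      let ?E = "{s \<in> E. \<not> emb t s}"
      have "downset A ?E"
        using True unfolding downset_def by (auto intro: emb_trans)
      moreover have "?E \<subset> E"
        using t(1) emb_refl by blast
      ultimately obtain n where
        "\<forall>s\<in>?E. \<forall>u\<in>?E. pieces A n s = pieces A n u \<longrightarrow> (s \<in> L \<longleftrightarrow> u \<in> L)"
        using 1[of ?E] True by (simp only: mem_Collect_eq case_prod_conv) blast
      then have n: "s \<in> L \<longleftrightarrow> u \<in> L" if "s \<in> ?E" "u \<in> ?E" "pieces A n s = pieces A n u" for s u
        using that by blast
      \<comment> \<open>At this size \<open>t\<close> itself is among the pieces tested, so they
        reveal whether a forest lies above \<open>t\<close>. If it does, \<open>c\<close> is the
        answer; otherwise the forest is in \<open>?E\<close>, where the pieces up to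
        \<open>n\<close> decide.\<close>
      let ?n = "max n (fsize t)"
      have "s \<in> L \<longleftrightarrow> u \<in> L" if "s \<in> E" "u \<in> E" and eq: "pieces A ?n s = pieces A ?n u" for s u
      proof -
        have "t \<in> pieces A ?n v \<longleftrightarrow> emb t v" for v
          using True t(1) by (auto simp: pieces_def downset_def)
        then have t_iff: "emb t s \<longleftrightarrow> emb t u"
          using eq by metis
        have "pieces A n v = {b \<in> pieces A ?n v. fsize b \<le> n}" for v :: "'a forest"
          by (auto simp: pieces_def)
        then have "pieces A n s = pieces A n u"
          using eq by metis
        with t_iff show ?thesis
          using that(1,2) n[of s u] t(2)[of s] t(2)[of u] by blast
      qed
      then show ?thesis
        by blast
    qed auto
  qed
  moreover have "downset A (forests A)"
    using emb_labels by (auto simp: downset_def)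
  ultimately show False
    using assms(2) unfolding testable_iff by blast
qed

text \<open>A forest over \<open>A\<close> lies outside \<open>D\<close> exactly if it is above a
  member of a finite basis of the complement. A bound on the sizes in that basis serves as
  \<open>n\<close>.\<close>

lemma downset_determined_by_pieces:
  assumes "finite A" "downset A D"
  shows "\<exists>n. \<forall>s \<in> forests A. \<forall>t \<in> forests A. pieces A n s = pieces A n t \<longrightarrow> (s \<in> D \<longleftrightarrow> t \<in> D)"
proof -
  obtain B where B: "B \<subseteq> forests A - D" "finite B" "\<And>t. t \<in> forests A - D \<Longrightarrow> \<exists>b\<in>B. emb b t"
    using good_on_finite_basis[OF kruskal[OF assms(1)], of "forests A - D"] by blast
  obtain n where n: "\<And>b. b \<in> B \<Longrightarrow> fsize b \<le> n"
    using finite_nat_set_iff_bounded_le[of "fsize ` B"] B(2) by auto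
  have "s \<notin> D" if st: "s \<in> forests A" "t \<in> forests A" "pieces A n s = pieces A n t" "t \<notin> D" for s t
  proof -
    obtain b where b: "b \<in> B" "emb b t"
      using B(3) st by blast
    then have "b \<in> pieces A n s"
      using st b B(1) n by (auto simp: pieces_def)
    then show ?thesis
      using b B(1) assms(2) by (auto simp: pieces_def downset_def)
  qed
  then show ?thesis
    by (intro exI[of _ n]) metis
qed

section \<open>Certificates\<close>

text \<open>A deterministic bottom-up automaton on the binary reading of forests. It takes the place
  of the forest algebra, where \<open>s a x y\<close> is the letter \<open>a\<close> applied to
  \<open>x\<close>, plus \<open>y\<close>.\<close>

fun run :: "'q \<Rightarrow> ('a \<Rightarrow> 'q \<Rightarrow> 'q \<Rightarrow> 'q) \<Rightarrow> 'a forest \<Rightarrow> 'q" where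
  "run z s [] = z"
| "run z s (Node a f # g) = s a (run z s f) (run z s g)"

definition automaton :: "nat \<Rightarrow> nat \<Rightarrow> nat \<Rightarrow> (nat \<Rightarrow> nat \<Rightarrow> nat \<Rightarrow> nat) \<Rightarrow> bool" where
  "automaton k q z s \<longleftrightarrow> z < q \<and> (\<forall>a<k. \<forall>x<q. \<forall>y<q. s a x y < q)"

definition automaton_hom ::
  "nat \<Rightarrow> nat \<Rightarrow> nat \<Rightarrow> (nat \<Rightarrow> nat \<Rightarrow> nat \<Rightarrow> nat) \<Rightarrow> nat \<Rightarrow> (nat \<Rightarrow> nat \<Rightarrow> nat \<Rightarrow> nat) \<Rightarrow> (nat \<Rightarrow> nat) \<Rightarrow> bool" where
  "automaton_hom k q z s z' s' h \<longleftrightarrow> h z = z' \<and>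
     (\<forall>a<k. \<forall>x<q. \<forall>y<q. h (s a x y) = s' a (h x) (h y))"

lemma run_less: "automaton k q z s \<Longrightarrow> t \<in> forests {..<k} \<Longrightarrow> run z s t < q"
  by (induction t rule: forest_induct) (auto simp: automaton_def)

lemma run_hom:
  "automaton k q z s \<Longrightarrow> automaton_hom k q z s z' s' h \<Longrightarrow> t \<in> forests {..<k} \<Longrightarrow>
    h (run z s t) = run z' s' t"
proof (induction t rule: forest_induct)
  case (Cons a f g)
  then show ?case
    using run_less[OF Cons.prems(1)] by (simp add: automaton_hom_def)
qed (simp add: automaton_hom_def)

text \<open>
  The conditions on the preorder \<open>leq\<close> mirror the rules of \<^const>\<open>emb\<close>, so that larger forests
  have larger values. Any automaton with such a preorder recognizes a testable language because
  the forests of value at least \<open>x\<close> have a finite basis.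
\<close>

locale testable_cert =
  fixes k hz :: nat and hs :: "nat \<Rightarrow> nat \<Rightarrow> nat \<Rightarrow> nat" and X :: "nat \<Rightarrow> bool"
    and q z :: nat and s :: "nat \<Rightarrow> nat \<Rightarrow> nat \<Rightarrow> nat" and h :: "nat \<Rightarrow> nat"
    and leq :: "nat \<Rightarrow> nat \<Rightarrow> bool"
  assumes aut: "automaton k q z s" and hom: "automaton_hom k q z s hz hs h"
    and leq: "\<forall>x<q. leq z x \<and> leq x x"
    and leq_trans: "\<forall>x<q. \<forall>y<q. \<forall>w<q. leq x y \<longrightarrow> leq y w \<longrightarrow> leq x w"
    and leq_right: "\<forall>a<k. \<forall>x<q. \<forall>y<q. leq y (s a x y)"
    and leq_mono: "\<forall>a<k. \<forall>x<q. \<forall>y<q. \<forall>x'<q. \<forall>y'<q.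
      leq x x' \<longrightarrow> leq y y' \<longrightarrow> leq (s a x y) (s a x' y')"
    and leq_down: "\<forall>a<k. \<forall>b<k. \<forall>x<q. \<forall>y<q. leq (s a x y) (s b (s a x z) y)"
    and leq_accept: "\<forall>x<q. \<forall>y<q. leq x y \<longrightarrow> leq y x \<longrightarrow> (X (h x) \<longleftrightarrow> X (h y))"
begin

lemma leq_run:
  "emb t u \<Longrightarrow> t \<in> forests {..<k} \<Longrightarrow> u \<in> forests {..<k} \<Longrightarrow> leq (run z s t) (run z s u)"
proof (induction rule: emb.induct)
  note [simp] = run_less[OF aut]
  note trans = leq_trans[rule_format]
  have [simp]: "z < q" "\<And>a x y. a < k \<Longrightarrow> x < q \<Longrightarrow> y < q \<Longrightarrow> s a x y < q"
    using aut by (simp_all add: automaton_def)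
  {
    case (Nil t)
    then show ?case
      using leq[rule_format, THEN conjunct1] by simp
  next
    case (skip t u v)
    obtain b f where [simp]: "v = Node b f"
      by (cases v)
    show ?case
      using skip trans[OF _ _ _ skip.IH leq_right[rule_format], of b "run z s f"] by simp
  next
    case (match f f' g g' a)
    then show ?case
      using leq_mono[rule_format, of a] by simp
  next
    case (descend v f' g g' b)
    obtain a f where [simp]: "v = Node a f"
      by (cases v)
    \<comment> \<open>The value in the middle is that of the forest in which the tree
      \<open>v\<close> alone sits below a new root \<open>b\<close>; the argument \<open>z\<close>
      stands for its missing siblings. Monotonicity then enlarges the two parts.\<close>
    have "leq (s a (run z s f) (run z s g)) (s b (s a (run z s f) z) (run z s g))"
      using leq_down[rule_format] descend.prems by simp
    moreover have "leq (s b (s a (run z s f) z) (run z s g)) (s b (run z s f') (run z s g'))"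
      using descend by (intro leq_mono[rule_format]) simp_all
    ultimately have "leq (s a (run z s f) (run z s g)) (s b (run z s f') (run z s g'))"
      by (rule trans[rotated 3]) (use descend.prems in simp_all)
    then show ?case
      by simp
  }
qed

lemma sound: "cca_piecewise_testable {..<k} {t \<in> forests {..<k}. X (run hz hs t)}"
proof -
  let ?F = "forests {..<k}"
  have "\<forall>x. \<exists>B. B \<subseteq> {t \<in> ?F. leq x (run z s t)} \<and> finite B \<and>
      (\<forall>t \<in> {t \<in> ?F. leq x (run z s t)}. \<exists>b \<in> B. emb b t)"
    by (intro allI good_on_finite_basis[OF kruskal[of "{..<k}"]]) auto
  from choice[OF this] obtain B where *: "\<forall>x. B x \<subseteq> {t \<in> ?F. leq x (run z s t)} \<and> finite (B x) \<and>
      (\<forall>t \<in> {t \<in> ?F. leq x (run z s t)}. \<exists>b \<in> B x. emb b t)"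
    by (rule exE)
  have B: "B x \<subseteq> {t \<in> ?F. leq x (run z s t)}" "finite (B x)" for x
    using * by simp_all
  have basis: "\<exists>b \<in> B x. emb b t" if "t \<in> ?F" "leq x (run z s t)" for x t
    using * that by simp
  have "finite (\<Union>x<q. B x)"
    using B(2) by simp
  then obtain n where n: "\<And>x b. x < q \<Longrightarrow> b \<in> B x \<Longrightarrow> fsize b \<le> n"
    using finite_nat_set_iff_bounded_le[of "fsize ` (\<Union>x<q. B x)"] by auto
  \<comment> \<open>A basis element \<open>b\<close> below \<open>t\<close>, of value at least that
    of \<open>t\<close>, is small and hence a piece of \<open>u\<close> too. So the value of
    \<open>u\<close> is at least that of \<open>b\<close>, and then at least that of
    \<open>t\<close>. By symmetry the two values are equivalent.\<close>
  have le: "leq (run z s t) (run z s u)"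
    if tu: "t \<in> ?F" "u \<in> ?F" "pieces {..<k} n t = pieces {..<k} n u" for t u
  proof -
    let ?x = "run z s t"
    have lt: "?x < q" "run z s u < q"
      using run_less[OF aut] tu by auto
    obtain b where b: "b \<in> B ?x" "emb b t"
      using basis[OF tu(1) leq[rule_format, THEN conjunct2, OF lt(1)]] by blast
    then have "b \<in> pieces {..<k} n t"
      using B(1)[of ?x] n[OF lt(1)] by (auto simp: pieces_def)
    then have "emb b u"
      unfolding tu(3) by (simp add: pieces_def)
    moreover have b': "b \<in> ?F" "leq ?x (run z s b)"
      using B(1)[of ?x] b(1) by auto
    ultimately have "leq (run z s b) (run z s u)"
      using leq_run tu(2) by blast
    then show ?thesis
      using leq_trans[rule_format] lt run_less[OF aut b'(1)] b'(2) by blast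
  qed
  have "X (run hz hs t) \<longleftrightarrow> X (run hz hs u)"
    if tu: "t \<in> ?F" "u \<in> ?F" "pieces {..<k} n t = pieces {..<k} n u" for t u
    using leq_accept[rule_format, OF run_less[OF aut tu(1)] run_less[OF aut tu(2)] le[OF tu] le[OF tu(2,1) tu(3)[symmetric]]]
    by (simp add: run_hom[OF aut hom] tu)
  then have "\<forall>t \<in> ?F. \<forall>u \<in> ?F. pieces {..<k} n t = pieces {..<k} n u \<longrightarrow>
      (t \<in> {t \<in> ?F. X (run hz hs t)} \<longleftrightarrow> u \<in> {t \<in> ?F. X (run hz hs t)})"
    by blast
  then show ?thesis
    unfolding testable_iff by (rule exI)
qed

end

text \<open>
  An automaton \<open>(q, z, s)\<close> refining the given one, with a set
  \<open>d\<close> of states, presents an alternating set. A second automaton \<open>(p, mz, ms)\<close> refining the first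
  one computes for each forest a set of states, given by \<open>\<rho>\<close>, that are attained by larger
  forests. That \<open>e a x1 x2 x\<close> is positive means that if \<open>f\<close> and \<open>g\<close> have the values \<open>x1\<close> and \<open>x2\<close>
  then some forest above \<open>Node a f # g\<close> has the value \<open>x\<close>. The ranks \<open>r\<close> and \<open>e\<close> make the
  justifications well-founded.
\<close>

locale nontestable_cert =
  fixes k hz :: nat and hs :: "nat \<Rightarrow> nat \<Rightarrow> nat \<Rightarrow> nat" and X :: "nat \<Rightarrow> bool"
    and q z :: nat and s :: "nat \<Rightarrow> nat \<Rightarrow> nat \<Rightarrow> nat" and h :: "nat \<Rightarrow> nat"
    and p mz :: nat and ms :: "nat \<Rightarrow> nat \<Rightarrow> nat \<Rightarrow> nat" and mh :: "nat \<Rightarrow> nat"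
    and r :: "nat \<Rightarrow> nat" and e :: "nat \<Rightarrow> nat \<Rightarrow> nat \<Rightarrow> nat \<Rightarrow> nat"
    and \<rho> :: "nat \<Rightarrow> nat \<Rightarrow> bool" and d :: "nat \<Rightarrow> bool"
  assumes aut: "automaton k q z s" and hom: "automaton_hom k q z s hz hs h"
    and maut: "automaton k p mz ms" and mhom: "automaton_hom k p mz ms z s mh"
    and rank: "\<forall>x<q. x = z \<or> (\<exists>b<k. \<exists>y<q. \<exists>w<q. r y < r x \<and> r w < r x \<and> x = s b y w)"
    and ext: "\<forall>a<k. \<forall>x1<q. \<forall>x2<q. \<forall>x<q. 0 < e a x1 x2 x \<longrightarrow>
      x = s a x1 x2 \<or>
      (\<exists>b<k. \<exists>y<q. \<exists>w<q. 0 < e a x1 x2 w \<and> e a x1 x2 w < e a x1 x2 x \<and> x = s b y w) \<or>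
      (\<exists>b<k. \<exists>y<q. \<exists>w<q. 0 < e a x1 y w \<and> e a x1 y w < e a x1 x2 x \<and> x = s b w x2)"
    and above: "\<forall>a<k. \<forall>m1<p. \<forall>m2<p. \<forall>x<q. \<rho> (ms a m1 m2) x \<longrightarrow>
      (\<exists>x1<q. \<exists>x2<q. \<rho> m1 x1 \<and> \<rho> m2 x2 \<and> 0 < e a x1 x2 x)"
    and cofinal: "\<forall>m<p. d (mh m) \<longrightarrow>
      (\<exists>x<q. \<rho> m x \<and> d x \<and> X (h x)) \<and> (\<exists>x<q. \<rho> m x \<and> d x \<and> \<not> X (h x))"
    and nonempty: "\<exists>x<q. d x"
begin

text \<open>Ranks decrease along justifications, so unwinding them ends and builds a forest.
  Attained states are what permits inserting material of any prescribed value later.\<close>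

lemma reach: "x < q \<Longrightarrow> \<exists>t \<in> forests {..<k}. run z s t = x"
proof (induction "r x" arbitrary: x rule: less_induct)
  case less
  show ?case
  proof (cases "x = z")
    case False
    then obtain b y w where b: "b < k" "y < q" "w < q" "r y < r x" "r w < r x" "x = s b y w"
      using rank[rule_format, OF less.prems] by blast
    obtain f g where "f \<in> forests {..<k}" "run z s f = y" "g \<in> forests {..<k}" "run z s g = w"
      using less.hyps b by meson
    then show ?thesis
      using b by (intro bexI[of _ "Node b f # g"]) auto
  qed (auto intro!: bexI[of _ "[]"])
qed

lemma ext_run:
  assumes "a < k" "x < q" "0 < e a (run z s f) (run z s g) x" "f \<in> forests {..<k}" "g \<in> forests {..<k}"
  shows "\<exists>t \<in> forests {..<k}. emb (Node a f # g) t \<and> run z s t = x"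
  using assms
\<comment> \<open>The forest \<open>g\<close> has to vary because the third kind of justification
  continues with other siblings \<open>u\<close> in its place.\<close>
proof (induction "e a (run z s f) (run z s g) x" arbitrary: x g rule: less_induct)
  case less
  note run = run_less[OF aut]
  from ext[rule_format, OF less.prems(1) run[OF less.prems(4)] run[OF less.prems(5)] less.prems(2,3)]
  show ?case
  proof (elim disjE exE conjE)
    assume "x = s a (run z s f) (run z s g)"
    then show ?thesis
      using less.prems by (intro bexI[of _ "Node a f # g"]) (auto intro: emb_refl)
  next
    fix b y w assume b: "b < k" "y < q" "w < q" "0 < e a (run z s f) (run z s g) w"
      "e a (run z s f) (run z s g) w < e a (run z s f) (run z s g) x" "x = s b y w"
    obtain t where "t \<in> forests {..<k}" "emb (Node a f # g) t" "run z s t = w"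
      using less.hyps[OF b(5) less.prems(1) b(3,4) less.prems(4,5)] by blast
    moreover obtain u where "u \<in> forests {..<k}" "run z s u = y"
      using reach[OF b(2)] by blast
    ultimately show ?thesis
      using b by (intro bexI[of _ "Node b u # t"]) (auto intro: emb.skip)
  next
    \<comment> \<open>The tree \<open>Node a f\<close> moves below a new root \<open>b\<close>,
      inside a forest \<open>t\<close> above \<open>Node a f # u\<close>, where the siblings
      \<open>u\<close> may have any value \<open>y\<close>. The forest \<open>g\<close> stays beside
      the new root.\<close>
    fix b y w assume b: "b < k" "y < q" "w < q" "0 < e a (run z s f) y w"
      "e a (run z s f) y w < e a (run z s f) (run z s g) x" "x = s b w (run z s g)"
    obtain u where u: "u \<in> forests {..<k}" "run z s u = y"
      using reach[OF b(2)] by blast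
    then obtain t where "t \<in> forests {..<k}" "emb (Node a f # u) t" "run z s t = w"
      using less.hyps[of u w] b less.prems by auto
    moreover from this(2) have "emb [Node a f] t"
      by (rule emb_trans[rotated]) (intro emb.match emb_refl emb.Nil)
    ultimately show ?thesis
      using b less.prems by (intro bexI[of _ "Node b t # g"]) (auto intro: emb.descend emb_refl)
  qed
qed

text \<open>Children and siblings are first enlarged separately to forests of the values
  \<open>x1\<close> and \<open>x2\<close>; then \<open>ext_run\<close> enlarges the result and
  transitivity combines the two steps.\<close>

lemma attained:
  "t \<in> forests {..<k} \<Longrightarrow> x < q \<Longrightarrow> \<rho> (run mz ms t) x \<Longrightarrow>
    \<exists>u \<in> forests {..<k}. emb t u \<and> run z s u = x"
proof (induction t arbitrary: x rule: forest_induct)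
  case Nil
  then show ?case
    using reach emb.Nil by blast
next
  case (Cons a f g)
  then have F: "a < k" "f \<in> forests {..<k}" "g \<in> forests {..<k}"
    by auto
  then obtain x1 x2 where x: "x1 < q" "x2 < q" "\<rho> (run mz ms f) x1" "\<rho> (run mz ms g) x2"
    "0 < e a x1 x2 x"
    using above[rule_format, OF F(1) run_less[OF maut F(2)] run_less[OF maut F(3)] Cons.prems(2)] Cons.prems(3)
    by auto
  obtain f' g' where f': "f' \<in> forests {..<k}" "emb f f'" "run z s f' = x1"
    and g': "g' \<in> forests {..<k}" "emb g g'" "run z s g' = x2"
    using Cons.IH F x by meson
  obtain u where "u \<in> forests {..<k}" "emb (Node a f' # g') u" "run z s u = x"
    using ext_run[OF F(1) Cons.prems(2) _ f'(1) g'(1)] x(5) f'(3) g'(3) by auto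
  then show ?case
    using emb_trans[OF emb.match[OF f'(2) g'(2)]] by blast
qed

lemma sound: "\<not> cca_piecewise_testable {..<k} {t \<in> forests {..<k}. X (run hz hs t)}"
proof -
  let ?F = "forests {..<k}"
  let ?D = "{t \<in> ?F. d (run z s t)}"
  obtain x where "x < q" "d x"
    using nonempty by blast
  then have "?D \<noteq> {}"
    using reach[of x] by auto
  moreover have "alternating {t \<in> ?F. X (run hz hs t)} ?D"
    unfolding alternating_def
  proof
    fix t assume t: "t \<in> ?D"
    have "mh (run mz ms t) = run z s t"
      using run_hom[OF maut mhom] t by simp
    then obtain x y where "x < q" "\<rho> (run mz ms t) x" "d x" "X (h x)"
      "y < q" "\<rho> (run mz ms t) y" "d y" "\<not> X (h y)"
      using cofinal[rule_format, OF run_less[OF maut], of t] t by auto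
    moreover from this obtain u v where "u \<in> ?F" "emb t u" "run z s u = x"
      "v \<in> ?F" "emb t v" "run z s v = y"
      using attained t by (metis (mono_tags, lifting) mem_Collect_eq)
    ultimately show "(\<exists>s\<in>?D. emb t s \<and> s \<in> {t \<in> ?F. X (run hz hs t)}) \<and>
        (\<exists>s\<in>?D. emb t s \<and> s \<notin> {t \<in> ?F. X (run hz hs t)})"
      using run_hom[OF aut hom, of u] run_hom[OF aut hom, of v] by auto
  qed
  ultimately show ?thesis
    by (intro alternating_imp_not_testable) auto
qed

end

section \<open>Quotient automata and completeness of the certificates\<close>

lemma quotient_automaton:
  fixes F :: "nat forest \<Rightarrow> 'x"
  assumes fin: "finite (F ` forests {..<k})"
    and cong: "\<And>a f f' g g'. a < k \<Longrightarrow> f \<in> forests {..<k} \<Longrightarrow> f' \<in> forests {..<k} \<Longrightarrow>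
      g \<in> forests {..<k} \<Longrightarrow> g' \<in> forests {..<k} \<Longrightarrow> F f = F f' \<Longrightarrow> F g = F g' \<Longrightarrow>
      F (Node a f # g) = F (Node a f' # g')"
  obtains q z s rep where "automaton k q z s"
    "\<And>x. x < q \<Longrightarrow> rep x \<in> forests {..<k}" "\<And>x. x < q \<Longrightarrow> run z s (rep x) = x"
    "\<And>t. t \<in> forests {..<k} \<Longrightarrow> F (rep (run z s t)) = F t"
proof -
  let ?F = "forests {..<k}"
  \<comment> \<open>States number the values of \<open>F\<close>, and transitions are computed on
    representatives, which the congruence makes harmless. Any data that depend only on
    \<open>F\<close> can then be read off at \<open>rep x\<close>.\<close>
  define q where "q = card (F ` ?F)"
  obtain c where c: "bij_betw c (F ` ?F) {0..<q}"
    using ex_bij_betw_finite_nat[OF fin] unfolding q_def by blast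
  define \<kappa> where "\<kappa> t = c (F t)" for t
  have \<kappa>: "\<kappa> t < q" if "t \<in> ?F" for t
    using bij_betwE[OF c] that by (auto simp: \<kappa>_def)
  have eq: "\<kappa> t = \<kappa> u \<longleftrightarrow> F t = F u" if "t \<in> ?F" "u \<in> ?F" for t u
    using bij_betw_imp_inj_on[OF c] that unfolding \<kappa>_def by (auto simp: inj_on_eq_iff)
  define rep where "rep x = (SOME t. t \<in> ?F \<and> \<kappa> t = x)" for x
  have rep: "rep x \<in> ?F \<and> \<kappa> (rep x) = x" if "x < q" for x
    unfolding rep_def
  proof (rule someI_ex)
    have "x \<in> c ` F ` ?F"
      using bij_betw_imp_surj_on[OF c] that by simp
    then show "\<exists>t. t \<in> ?F \<and> \<kappa> t = x"
      by (auto simp: \<kappa>_def)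
  qed
  have F_rep: "F (rep (\<kappa> t)) = F t" if "t \<in> ?F" for t
    using eq[of "rep (\<kappa> t)" t] rep[OF \<kappa>[OF that]] that by simp
  define s where "s a x y = \<kappa> (Node a (rep x) # rep y)" for a x y
  have run: "run (\<kappa> []) s t = \<kappa> t" if "t \<in> ?F" for t
    using that
  proof (induction t rule: forest_induct)
    case (Cons a f g)
    then have "F (Node a (rep (\<kappa> f)) # rep (\<kappa> g)) = F (Node a f # g)"
      using rep[OF \<kappa>] F_rep by (intro cong) auto
    then show ?case
      using Cons by (simp add: s_def \<kappa>_def)
  qed simp
  show ?thesis
  proof (rule that)
    show "automaton k q (\<kappa> []) s"
      using \<kappa> rep by (simp add: automaton_def s_def)
    show "rep x \<in> ?F" "run (\<kappa> []) s (rep x) = x" if "x < q" for x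
      using rep[OF that] run by auto
    show "F (rep (run (\<kappa> []) s t)) = F t" if "t \<in> ?F" for t
      using run[OF that] F_rep[OF that] by simp
  qed
qed

lemma quotient_hom:
  assumes aut: "automaton k q z s"
    and rep: "\<And>x. x < q \<Longrightarrow> rep x \<in> forests {..<k}" "\<And>x. x < q \<Longrightarrow> run z s (rep x) = x"
    and run: "\<And>t. t \<in> forests {..<k} \<Longrightarrow> run z' s' (rep (run z s t)) = run z' s' t"
  shows "automaton_hom k q z s z' s' (\<lambda>x. run z' s' (rep x))"
  unfolding automaton_hom_def
proof (intro conjI allI impI)
  show "run z' s' (rep z) = z'"
    using run[of "[]"] by simp
  fix a x y assume "a < k" "x < q" "y < q"
  then show "run z' s' (rep (s a x y)) = s' a (run z' s' (rep x)) (run z' s' (rep y))"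
    using run[of "Node a (rep x) # rep y"] rep by simp
qed

text \<open>The invariant pairs the pieces with the value in the given automaton, so that the
  quotient also refines the latter.\<close>

lemma pieces_automaton:
  assumes "automaton k m hz hs"
  obtains q z s rep where "automaton k q z s"
    "\<And>x. x < q \<Longrightarrow> rep x \<in> forests {..<k}" "\<And>x. x < q \<Longrightarrow> run z s (rep x) = x"
    "\<And>t. t \<in> forests {..<k} \<Longrightarrow> run hz hs (rep (run z s t)) = run hz hs t"
    "\<And>t. t \<in> forests {..<k} \<Longrightarrow> pieces {..<k} n (rep (run z s t)) = pieces {..<k} n t"
proof -
  define F where "F t = (run hz hs t, pieces {..<k} n t)" for t
  have "F ` forests {..<k} \<subseteq> {..<m} \<times> Pow {t \<in> forests {..<k}. fsize t \<le> n}"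
    using run_less[OF assms] by (auto simp: F_def pieces_def)
  then have fin: "finite (F ` forests {..<k})"
    by (rule finite_subset) (simp add: finite_forests)
  have cong: "F (Node a f # g) = F (Node a f' # g')" if "F f = F f'" "F g = F g'" for a f f' g g'
  proof -
    have "pieces {..<k} n (Node a f # g) = pieces {..<k} n (Node a f' # g')"
      using that by (intro equalityI pieces_Cons_mono) (auto simp: F_def)
    then show ?thesis
      using that by (simp add: F_def)
  qed
  obtain q z s rep where Q: "automaton k q z s"
    "\<And>x. x < q \<Longrightarrow> rep x \<in> forests {..<k}" "\<And>x. x < q \<Longrightarrow> run z s (rep x) = x"
    "\<And>t. t \<in> forests {..<k} \<Longrightarrow> F (rep (run z s t)) = F t"
    by (rule quotient_automaton[OF fin cong]; blast)
  show ?thesis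
  proof (rule that)
    show "run hz hs (rep (run z s t)) = run hz hs t" "pieces {..<k} n (rep (run z s t)) = pieces {..<k} n t"
      if "t \<in> forests {..<k}" for t
      using Q(4)[OF that] by (simp_all add: F_def)
  qed (fact Q)+
qed

lemma testable_cert_complete:
  assumes H: "automaton k m hz hs"
    and PT: "cca_piecewise_testable {..<k} {t \<in> forests {..<k}. X (run hz hs t)}"
  shows "\<exists>q z s h leq. testable_cert k hz hs X q z s h leq"
proof -
  let ?F = "forests {..<k}" and ?L = "{t \<in> forests {..<k}. X (run hz hs t)}"
  obtain n where n: "\<forall>t\<in>?F. \<forall>u\<in>?F. pieces {..<k} n t = pieces {..<k} n u \<longrightarrow> (t \<in> ?L \<longleftrightarrow> u \<in> ?L)"
    using PT unfolding testable_iff by (rule exE)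
  obtain q z s rep where aut: "automaton k q z s"
    and rep: "\<And>x. x < q \<Longrightarrow> rep x \<in> ?F" "\<And>x. x < q \<Longrightarrow> run z s (rep x) = x"
    and hrun: "\<And>t. t \<in> ?F \<Longrightarrow> run hz hs (rep (run z s t)) = run hz hs t"
    and P: "\<And>t. t \<in> ?F \<Longrightarrow> pieces {..<k} n (rep (run z s t)) = pieces {..<k} n t"
    by (rule pieces_automaton[OF H, of n]; blast)
  have z: "pieces {..<k} n (rep z) = pieces {..<k} n []"
    using P[of "[]"] by simp
  have step: "pieces {..<k} n (rep (s a x y)) = pieces {..<k} n (Node a (rep x) # rep y)"
    if "a < k" "x < q" "y < q" for a x y
    using P[of "Node a (rep x) # rep y"] rep that by simp
  \<comment> \<open>The preorder is inclusion of small pieces. Equivalent states then have equal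
    small pieces, and by the choice of \<open>n\<close> acceptance agrees on them.\<close>
  have "testable_cert k hz hs X q z s (\<lambda>x. run hz hs (rep x))
      (\<lambda>x y. pieces {..<k} n (rep x) \<subseteq> pieces {..<k} n (rep y))"
  proof
    show "automaton k q z s"
      by (rule aut)
    show "automaton_hom k q z s hz hs (\<lambda>x. run hz hs (rep x))"
      by (rule quotient_hom[OF aut rep hrun])
    show "\<forall>x<q. pieces {..<k} n (rep z) \<subseteq> pieces {..<k} n (rep x) \<and>
        pieces {..<k} n (rep x) \<subseteq> pieces {..<k} n (rep x)"
      unfolding z by (intro allI impI conjI pieces_mono emb.Nil subset_refl)
    show "\<forall>a<k. \<forall>x<q. \<forall>y<q. pieces {..<k} n (rep y) \<subseteq> pieces {..<k} n (rep (s a x y))"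
      by (intro allI impI) (simp only: step, intro pieces_mono emb.skip emb_refl)
    show "\<forall>a<k. \<forall>x<q. \<forall>y<q. \<forall>x'<q. \<forall>y'<q. pieces {..<k} n (rep x) \<subseteq> pieces {..<k} n (rep x') \<longrightarrow>
        pieces {..<k} n (rep y) \<subseteq> pieces {..<k} n (rep y') \<longrightarrow>
        pieces {..<k} n (rep (s a x y)) \<subseteq> pieces {..<k} n (rep (s a x' y'))"
      by (simp add: step pieces_Cons_mono)
    show "\<forall>a<k. \<forall>b<k. \<forall>x<q. \<forall>y<q.
        pieces {..<k} n (rep (s a x y)) \<subseteq> pieces {..<k} n (rep (s b (s a x z) y))"
    proof (intro allI impI)
      fix a b x y assume *: "a < k" "b < k" "x < q" "y < q"
      have lt: "z < q" "s a x z < q"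
        using aut * by (simp_all add: automaton_def)
      have "pieces {..<k} n (Node a (rep x) # rep y) \<subseteq> pieces {..<k} n (Node b [Node a (rep x)] # rep y)"
        by (intro pieces_mono emb.descend emb_refl)
      \<comment> \<open>The representative of \<open>s a x z\<close> has the same small pieces as
        the single tree \<open>[Node a (rep x)]\<close>, since that of \<open>z\<close> has those of
        the empty forest.\<close>
      also have "\<dots> \<subseteq> pieces {..<k} n (Node b (rep (s a x z)) # rep y)"
        using lt * by (intro pieces_Cons_mono) (simp_all add: step z pieces_Cons_mono)
      finally show "pieces {..<k} n (rep (s a x y)) \<subseteq> pieces {..<k} n (rep (s b (s a x z) y))"
        using lt * by (simp add: step)
    qed
    show "\<forall>x<q. \<forall>y<q. pieces {..<k} n (rep x) \<subseteq> pieces {..<k} n (rep y) \<longrightarrow>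
        pieces {..<k} n (rep y) \<subseteq> pieces {..<k} n (rep x) \<longrightarrow>
        X (run hz hs (rep x)) = X (run hz hs (rep y))"
    proof (intro allI impI)
      fix x y assume *: "x < q" "y < q" "pieces {..<k} n (rep x) \<subseteq> pieces {..<k} n (rep y)"
        "pieces {..<k} n (rep y) \<subseteq> pieces {..<k} n (rep x)"
      have "rep x \<in> ?L \<longleftrightarrow> rep y \<in> ?L"
        using n rep(1)[OF *(1)] rep(1)[OF *(2)] equalityI[OF *(3,4)] by blast
      then show "X (run hz hs (rep x)) = X (run hz hs (rep y))"
        using rep(1)[OF *(1)] rep(1)[OF *(2)] by simp
    qed
  qed blast
  then show ?thesis
    by blast
qed

text \<open>
  The values \<open>x\<close> of forests above \<open>Node a f # g\<close>, where \<open>f\<close> and \<open>g\<close> have the values \<open>x1\<close> and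
  \<open>x2\<close>. The number \<open>i\<close> of insertions serves as the rank of a derivation.
\<close>

inductive extension :: "nat \<Rightarrow> nat \<Rightarrow> (nat \<Rightarrow> nat \<Rightarrow> nat \<Rightarrow> nat) \<Rightarrow> nat \<Rightarrow> nat \<Rightarrow> nat \<Rightarrow> nat \<Rightarrow> nat \<Rightarrow> bool"
  for k q :: nat and s :: "nat \<Rightarrow> nat \<Rightarrow> nat \<Rightarrow> nat" where
  base: "extension k q s 0 a x1 x2 (s a x1 x2)"
| right: "extension k q s i a x1 x2 w \<Longrightarrow> b < k \<Longrightarrow> y < q \<Longrightarrow> extension k q s (Suc i) a x1 x2 (s b y w)"
| down: "extension k q s i a x1 y w \<Longrightarrow> b < k \<Longrightarrow> y < q \<Longrightarrow> extension k q s (Suc i) a x1 x2 (s b w x2)"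

text \<open>A composite forest uses only its label and the two sets of its parts. The set is
  therefore a congruence invariant with finitely many values, computable by an automaton.\<close>

fun larger_values :: "nat \<Rightarrow> nat \<Rightarrow> (nat \<Rightarrow> nat \<Rightarrow> nat \<Rightarrow> nat) \<Rightarrow> nat forest \<Rightarrow> nat set" where
  "larger_values k q s [] = {..<q}"
| "larger_values k q s (Node a f # g) =
    {x. \<exists>x1 \<in> larger_values k q s f. \<exists>x2 \<in> larger_values k q s g. \<exists>i. extension k q s i a x1 x2 x}"

lemma extension_less:
  assumes "automaton k q z s"
  shows "extension k q s i a x1 x2 x \<Longrightarrow> a < k \<Longrightarrow> x1 < q \<Longrightarrow> x2 < q \<Longrightarrow> x < q"
  by (induction rule: extension.induct) (use assms in \<open>auto simp: automaton_def\<close>)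

lemma larger_values_less:
  assumes "automaton k q z s" "t \<in> forests {..<k}"
  shows "larger_values k q s t \<subseteq> {..<q}"
  using assms(2)
proof (induction t rule: forest_induct)
  case (Cons a f g)
  then show ?case
    using extension_less[OF assms(1)] by (auto simp: subset_iff)
qed simp

text \<open>This is the inclusion that completeness needs: the larger members supplied by
  alternation must have values that the table lists.\<close>

lemma larger_values:
  assumes aut: "automaton k q z s"
  shows "emb t u \<Longrightarrow> t \<in> forests {..<k} \<Longrightarrow> u \<in> forests {..<k} \<Longrightarrow> run z s u \<in> larger_values k q s t"
proof (induction rule: emb.induct)
  note [simp] = run_less[OF aut]
  {
    case (Nil t)
    then show ?case
      by simp
  next
    case (skip t u v)
    obtain b f where v: "v = Node b f"
      by (cases v)
    show ?case
    proof (cases t rule: fsize.cases)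
      case 1
      then show ?thesis
        using skip.prems run_less[OF aut, of "v # u"] by simp
    next
      case (2 a f' g)
      have "b < k" "run z s f < q"
        using skip.prems v by auto
      moreover obtain x1 x2 i where "x1 \<in> larger_values k q s f'" "x2 \<in> larger_values k q s g"
        "extension k q s i a x1 x2 (run z s u)"
        using skip 2 v by auto
      ultimately show ?thesis
        using 2 v extension.right by fastforce
    qed
  next
    case (match f f' g g' a)
    then show ?case
      by (auto intro: extension.base)
  next
    case (descend v f' g g' b)
    obtain a f where v: "v = Node a f"
      by (cases v)
    \<comment> \<open>The single tree \<open>v\<close> has no siblings, so every state
      \<open>y\<close> is allowed there. This is why \<open>y\<close> in the rule
      \<open>down\<close> is independent of \<open>x2\<close>.\<close>
    obtain x1 y i where "x1 \<in> larger_values k q s f" "y < q" "extension k q s i a x1 y (run z s f')"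
      using descend.IH(1) descend.prems v by auto
    moreover have "run z s g' \<in> larger_values k q s g"
      using descend v by simp
    ultimately show ?case
      using descend.prems extension.down v by fastforce
  }
qed

text \<open>The bound on \<open>mh\<close> is carried along because the table for \<open>d\<close>,
  reliable only below \<open>q\<close>, is read at \<open>mh m\<close>.\<close>

lemma nontestable_cert_complete:
  assumes H: "automaton k m hz hs"
    and nPT: "\<not> cca_piecewise_testable {..<k} {t \<in> forests {..<k}. X (run hz hs t)}"
  shows "\<exists>q z s h p mz ms mh r e \<rho> d. nontestable_cert k hz hs X q z s h p mz ms mh r e \<rho> d \<and>
    (\<forall>m<p. mh m < q)"
proof -
  let ?F = "forests {..<k}" and ?L = "{t \<in> forests {..<k}. X (run hz hs t)}"
  obtain D where D: "downset {..<k} D" "D \<noteq> {}" "alternating ?L D"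
    using not_testable_imp_alternating[OF finite_lessThan nPT] by blast
  have DF: "D \<subseteq> ?F"
    using D(1) by (simp add: downset_def)
  obtain n where n: "\<forall>t\<in>?F. \<forall>u\<in>?F. pieces {..<k} n t = pieces {..<k} n u \<longrightarrow> (t \<in> D \<longleftrightarrow> u \<in> D)"
    using downset_determined_by_pieces[OF finite_lessThan D(1)] by (rule exE)
  obtain q z s rep where aut: "automaton k q z s"
    and rep: "\<And>x. x < q \<Longrightarrow> rep x \<in> ?F" "\<And>x. x < q \<Longrightarrow> run z s (rep x) = x"
    and hrun: "\<And>t. t \<in> ?F \<Longrightarrow> run hz hs (rep (run z s t)) = run hz hs t"
    and P: "\<And>t. t \<in> ?F \<Longrightarrow> pieces {..<k} n (rep (run z s t)) = pieces {..<k} n t"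
    by (rule pieces_automaton[OF H, of n]; blast)
  \<comment> \<open>The pieces up to \<open>n\<close> determine membership in \<open>D\<close>, so
    \<open>D\<close> is a union of classes and can be given by a set of states.\<close>
  have in_D: "rep (run z s t) \<in> D \<longleftrightarrow> t \<in> D" if "t \<in> ?F" for t
    using n P[OF that] rep(1)[OF run_less[OF aut that]] that by blast
  \<comment> \<open>The first component makes the second automaton refine the first one.\<close>
  define F where "F t = (run z s t, larger_values k q s t)" for t
  have "F ` ?F \<subseteq> {..<q} \<times> Pow {..<q}"
    using run_less[OF aut] larger_values_less[OF aut] by (auto simp: F_def)
  then have fin: "finite (F ` ?F)"
    by (rule finite_subset) simp
  have cong: "F (Node a f # g) = F (Node a f' # g')" if "F f = F f'" "F g = F g'" for a f f' g g'
    using that by (simp add: F_def)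
  obtain p mz ms mrep where maut: "automaton k p mz ms"
    and mrep: "\<And>m. m < p \<Longrightarrow> mrep m \<in> ?F" "\<And>m. m < p \<Longrightarrow> run mz ms (mrep m) = m"
    and FR: "\<And>t. t \<in> ?F \<Longrightarrow> F (mrep (run mz ms t)) = F t"
    by (rule quotient_automaton[OF fin cong]; blast)
  have mrun: "\<And>t. t \<in> ?F \<Longrightarrow> run z s (mrep (run mz ms t)) = run z s t"
    and R: "\<And>t. t \<in> ?F \<Longrightarrow> larger_values k q s (mrep (run mz ms t)) = larger_values k q s t"
    by (drule FR; simp add: F_def)+
  \<comment> \<open>A state has as rank the least size of a forest attaining it; the two parts of
    such a forest are smaller.\<close>
  define r where "r x = (LEAST i. \<exists>t \<in> ?F. run z s t = x \<and> fsize t = i)" for x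
  \<comment> \<open>Zero is reserved for values without a derivation, hence the successor of the
    least number of insertions.\<close>
  define e where "e a x1 x2 x = (if \<exists>i. extension k q s i a x1 x2 x
    then Suc (LEAST i. extension k q s i a x1 x2 x) else 0)" for a x1 x2 x
  have r_le: "r (run z s t) \<le> fsize t" if "t \<in> ?F" for t
    unfolding r_def by (rule Least_le) (use that in blast)
  have e_le: "0 < e a x1 x2 x \<and> e a x1 x2 x \<le> Suc i" if "extension k q s i a x1 x2 x" for a x1 x2 x i
    using that unfolding e_def by (auto intro: Least_le)
  have "nontestable_cert k hz hs X q z s (\<lambda>x. run hz hs (rep x)) p mz ms (\<lambda>m. run z s (mrep m)) r e
      (\<lambda>m x. x \<in> larger_values k q s (mrep m)) (\<lambda>x. rep x \<in> D)"
  proof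
    show "automaton k q z s" "automaton k p mz ms"
      by (rule aut maut)+
    show "automaton_hom k q z s hz hs (\<lambda>x. run hz hs (rep x))"
      by (rule quotient_hom[OF aut rep hrun])
    show "automaton_hom k p mz ms z s (\<lambda>m. run z s (mrep m))"
      by (rule quotient_hom[OF maut mrep mrun])
    show "\<forall>x<q. x = z \<or> (\<exists>b<k. \<exists>y<q. \<exists>w<q. r y < r x \<and> r w < r x \<and> x = s b y w)"
    proof (intro allI impI)
      fix x assume x: "x < q"
      have "\<exists>i. \<exists>t \<in> ?F. run z s t = x \<and> fsize t = i"
        using rep[OF x] by blast
      from LeastI_ex[OF this] obtain t where t: "t \<in> ?F" "run z s t = x" "fsize t = r x"
        unfolding r_def by blast
      show "x = z \<or> (\<exists>b<k. \<exists>y<q. \<exists>w<q. r y < r x \<and> r w < r x \<and> x = s b y w)"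
      proof (cases t rule: fsize.cases)
        case (2 b f g)
        then have "b < k" "f \<in> ?F" "g \<in> ?F" "r (run z s f) < r x" "r (run z s g) < r x"
          using t r_le[of f] r_le[of g] by auto
        then show ?thesis
          using 2 t run_less[OF aut] by auto
      qed (use t in auto)
    qed
    show "\<forall>a<k. \<forall>x1<q. \<forall>x2<q. \<forall>x<q. 0 < e a x1 x2 x \<longrightarrow>
      x = s a x1 x2 \<or>
      (\<exists>b<k. \<exists>y<q. \<exists>w<q. 0 < e a x1 x2 w \<and> e a x1 x2 w < e a x1 x2 x \<and> x = s b y w) \<or>
      (\<exists>b<k. \<exists>y<q. \<exists>w<q. 0 < e a x1 y w \<and> e a x1 y w < e a x1 x2 x \<and> x = s b w x2)"
    proof (intro allI impI)
      fix a x1 x2 x assume lt: "a < k" "x1 < q" "x2 < q" "x < q" and pos: "0 < e a x1 x2 x"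
      then have "\<exists>i. extension k q s i a x1 x2 x"
        by (auto simp: e_def split: if_splits)
      from LeastI_ex[OF this] this obtain i where i: "extension k q s i a x1 x2 x" "e a x1 x2 x = Suc i"
        by (auto simp: e_def)
      from i(1) show "x = s a x1 x2 \<or>
        (\<exists>b<k. \<exists>y<q. \<exists>w<q. 0 < e a x1 x2 w \<and> e a x1 x2 w < e a x1 x2 x \<and> x = s b y w) \<or>
        (\<exists>b<k. \<exists>y<q. \<exists>w<q. 0 < e a x1 y w \<and> e a x1 y w < e a x1 x2 x \<and> x = s b w x2)"
      proof cases
        case (right j w b y)
        then have "w < q" "0 < e a x1 x2 w" "e a x1 x2 w < e a x1 x2 x"
          using i(2) lt e_le[OF right(3)] extension_less[OF aut right(3)] by auto
        then show ?thesis
          using right by blast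
      next
        case (down j y w b)
        then have "w < q" "0 < e a x1 y w" "e a x1 y w < e a x1 x2 x"
          using i(2) lt e_le[OF down(3)] extension_less[OF aut down(3)] by auto
        then show ?thesis
          using down by blast
      qed simp
    qed
    show "\<forall>a<k. \<forall>m1<p. \<forall>m2<p. \<forall>x<q. x \<in> larger_values k q s (mrep (ms a m1 m2)) \<longrightarrow>
      (\<exists>x1<q. \<exists>x2<q. x1 \<in> larger_values k q s (mrep m1) \<and> x2 \<in> larger_values k q s (mrep m2) \<and>
        0 < e a x1 x2 x)"
    proof (intro allI impI)
      fix a m1 m2 x assume *: "a < k" "m1 < p" "m2 < p" "x < q"
        and x: "x \<in> larger_values k q s (mrep (ms a m1 m2))"
      have "larger_values k q s (mrep (ms a m1 m2)) = larger_values k q s (Node a (mrep m1) # mrep m2)"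
        using R[of "Node a (mrep m1) # mrep m2"] mrep * by simp
      with x obtain x1 x2 i where "x1 \<in> larger_values k q s (mrep m1)" "x2 \<in> larger_values k q s (mrep m2)"
        "extension k q s i a x1 x2 x"
        by auto
      then show "\<exists>x1<q. \<exists>x2<q. x1 \<in> larger_values k q s (mrep m1) \<and> x2 \<in> larger_values k q s (mrep m2) \<and>
          0 < e a x1 x2 x"
        using larger_values_less[OF aut mrep(1)] * e_le by blast
    qed
    show "\<forall>m<p. rep (run z s (mrep m)) \<in> D \<longrightarrow>
      (\<exists>x<q. x \<in> larger_values k q s (mrep m) \<and> rep x \<in> D \<and> X (run hz hs (rep x))) \<and>
      (\<exists>x<q. x \<in> larger_values k q s (mrep m) \<and> rep x \<in> D \<and> \<not> X (run hz hs (rep x)))"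
    proof (intro allI impI)
      fix m assume m: "m < p" and "rep (run z s (mrep m)) \<in> D"
      then have "mrep m \<in> D"
        using in_D[OF mrep(1)[OF m]] by simp
      then obtain t u where tu: "t \<in> D" "emb (mrep m) t" "t \<in> ?L" "u \<in> D" "emb (mrep m) u" "u \<notin> ?L"
        using D(3) unfolding alternating_def by blast
      have *: "run z s v < q \<and> run z s v \<in> larger_values k q s (mrep m) \<and> rep (run z s v) \<in> D \<and>
          run hz hs (rep (run z s v)) = run hz hs v" if "v \<in> D" "emb (mrep m) v" for v
        using that DF run_less[OF aut] larger_values[OF aut that(2) mrep(1)[OF m]] in_D hrun by auto
      show "(\<exists>x<q. x \<in> larger_values k q s (mrep m) \<and> rep x \<in> D \<and> X (run hz hs (rep x))) \<and>
        (\<exists>x<q. x \<in> larger_values k q s (mrep m) \<and> rep x \<in> D \<and> \<not> X (run hz hs (rep x)))"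
        using *[OF tu(1,2)] *[OF tu(4,5)] tu(3,4,6) DF by auto
    qed
    show "\<exists>x<q. rep x \<in> D"
      using D(2) DF in_D run_less[OF aut] by (metis ex_in_conv subsetD)
  qed
  moreover have "\<forall>m<p. run z s (mrep m) < q"
    using run_less[OF aut] mrep(1) by blast
  ultimately show ?thesis
    by blast
qed

section \<open>The decision procedure\<close>

text \<open>
  In a presentation \<open>c\<close>, the entries 0, 3, 4, 7, 10 and 11 hold the size of the alphabet, the unit
  and the table of the horizontal monoid, the action, the images of the letters and the accepting
  set. The witness \<open>w\<close> lists the components of the certificate.
\<close>

definition testable_code :: "nat \<Rightarrow> nat \<Rightarrow> bool" where
  "testable_code c w \<longleftrightarrow> testable_cert (c $ 0) (c $ 3)
     (\<lambda>a x y. c $ 4 $ (c $ 7 $ (c $ 10 $ a) $ x) $ y) (\<lambda>x. c $ 11 $ x \<noteq> 0)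
     (w $ 0) (w $ 1) (\<lambda>a x y. w $ 2 $ a $ x $ y) (\<lambda>x. w $ 3 $ x) (\<lambda>x y. w $ 4 $ x $ y \<noteq> 0)"

definition nontestable_code :: "nat \<Rightarrow> nat \<Rightarrow> bool" where
  "nontestable_code c w \<longleftrightarrow> nontestable_cert (c $ 0) (c $ 3)
     (\<lambda>a x y. c $ 4 $ (c $ 7 $ (c $ 10 $ a) $ x) $ y) (\<lambda>x. c $ 11 $ x \<noteq> 0)
     (w $ 0) (w $ 1) (\<lambda>a x y. w $ 2 $ a $ x $ y) (\<lambda>x. w $ 3 $ x)
     (w $ 4) (w $ 5) (\<lambda>a x y. w $ 6 $ a $ x $ y) (\<lambda>x. w $ 7 $ x)
     (\<lambda>x. w $ 8 $ x) (\<lambda>a x1 x2 x. w $ 9 $ a $ x1 $ x2 $ x) (\<lambda>m x. w $ 10 $ m $ x \<noteq> 0)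
     (\<lambda>x. w $ 11 $ x \<noteq> 0)"

text \<open>Once unfolded, the certificate consists of bounded quantifiers over comparisons of table
  entries, each of which is covered by \<open>computable_intros\<close>.\<close>

lemma decidable_testable_code: "decidable (\<lambda>x. testable_code (fst (prod_decode x)) (snd (prod_decode x)))"
  unfolding testable_code_def testable_cert_def automaton_def automaton_hom_def
  by (intro computable_intros)

lemma decidable_nontestable_code:
  "decidable (\<lambda>x. nontestable_code (fst (prod_decode x)) (snd (prod_decode x)))"
  unfolding nontestable_code_def nontestable_cert_def automaton_def automaton_hom_def
  by (intro computable_intros)

text \<open>The conditions consult the functions only at letters below \<open>k\<close> and states
  below \<open>q\<close>, so tables with arbitrary entries elsewhere serve equally well.\<close>

lemma testable_cert_cong:
  assumes C: "testable_cert k hz hs X q z s h leq"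
    and [simp]: "\<forall>a<k. \<forall>x<q. \<forall>y<q. s' a x y = s a x y" "\<forall>x<q. h' x = h x"
      "\<forall>x<q. \<forall>y<q. leq' x y = leq x y"
  shows "testable_cert k hz hs X q z s' h' leq'"
proof -
  interpret testable_cert k hz hs X q z s h leq
    by (rule C)
  have [simp]: "z < q" "\<And>a x y. a < k \<Longrightarrow> x < q \<Longrightarrow> y < q \<Longrightarrow> s a x y < q"
    using aut by (auto simp: automaton_def)
  show ?thesis
  proof
    show "automaton k q z s'"
      using aut by (simp add: automaton_def)
    show "automaton_hom k q z s' hz hs h'"
      using hom by (simp add: automaton_hom_def)
    show "\<forall>x<q. leq' z x \<and> leq' x x"
      using leq by simp
    show "\<forall>x<q. \<forall>y<q. \<forall>w<q. leq' x y \<longrightarrow> leq' y w \<longrightarrow> leq' x w"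
    proof (intro allI impI)
      fix x y w assume "x < q" "y < q" "w < q" "leq' x y" "leq' y w"
      then show "leq' x w"
        using leq_trans[rule_format, of x y w] by simp
    qed
    show "\<forall>a<k. \<forall>x<q. \<forall>y<q. leq' y (s' a x y)"
      using leq_right by simp
    show "\<forall>a<k. \<forall>x<q. \<forall>y<q. \<forall>x'<q. \<forall>y'<q. leq' x x' \<longrightarrow> leq' y y' \<longrightarrow> leq' (s' a x y) (s' a x' y')"
      by (intro allI impI) (simp add: leq_mono)
    show "\<forall>a<k. \<forall>b<k. \<forall>x<q. \<forall>y<q. leq' (s' a x y) (s' b (s' a x z) y)"
      using leq_down by simp
    show "\<forall>x<q. \<forall>y<q. leq' x y \<longrightarrow> leq' y x \<longrightarrow> X (h' x) = X (h' y)"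
    proof (intro allI impI)
      fix x y assume "x < q" "y < q" "leq' x y" "leq' y x"
      then show "X (h' x) = X (h' y)"
        using leq_accept[rule_format, of x y] by simp
    qed
  qed
qed

text \<open>All arguments consulted stay in range; for \<open>d\<close> at \<open>mh m\<close> this
  is the last hypothesis.\<close>

lemma nontestable_cert_cong:
  assumes C: "nontestable_cert k hz hs X q z s h p mz ms mh r e \<rho> d"
    and [simp]: "\<forall>a<k. \<forall>x<q. \<forall>y<q. s' a x y = s a x y" "\<forall>x<q. h' x = h x"
      "\<forall>a<k. \<forall>x<p. \<forall>y<p. ms' a x y = ms a x y" "\<forall>x<p. mh' x = mh x"
      "\<forall>x<q. r' x = r x" "\<forall>a<k. \<forall>x1<q. \<forall>x2<q. \<forall>x<q. e' a x1 x2 x = e a x1 x2 x"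
      "\<forall>m<p. \<forall>x<q. \<rho>' m x = \<rho> m x" "\<forall>x<q. d' x = d x"
    and mh: "\<forall>m<p. mh m < q"
  shows "nontestable_cert k hz hs X q z s' h' p mz ms' mh' r' e' \<rho>' d'"
proof -
  interpret nontestable_cert k hz hs X q z s h p mz ms mh r e \<rho> d
    by (rule C)
  have [simp]: "z < q" "\<And>a x y. a < k \<Longrightarrow> x < q \<Longrightarrow> y < q \<Longrightarrow> s a x y < q"
    "mz < p" "\<And>a x y. a < k \<Longrightarrow> x < p \<Longrightarrow> y < p \<Longrightarrow> ms a x y < p" "\<And>m. m < p \<Longrightarrow> mh m < q"
    using aut maut mh by (auto simp: automaton_def)
  show ?thesis
  proof
    show "automaton k q z s'" "automaton k p mz ms'"
      using aut maut by (simp_all add: automaton_def)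
    show "automaton_hom k q z s' hz hs h'" "automaton_hom k p mz ms' z s' mh'"
      using hom mhom by (simp_all add: automaton_hom_def)
    show "\<forall>x<q. x = z \<or> (\<exists>b<k. \<exists>y<q. \<exists>w<q. r' y < r' x \<and> r' w < r' x \<and> x = s' b y w)"
    proof (intro allI impI)
      fix x assume "x < q"
      then show "x = z \<or> (\<exists>b<k. \<exists>y<q. \<exists>w<q. r' y < r' x \<and> r' w < r' x \<and> x = s' b y w)"
        using rank[rule_format, of x] by (simp cong: conj_cong)
    qed
    show "\<forall>a<k. \<forall>x1<q. \<forall>x2<q. \<forall>x<q. 0 < e' a x1 x2 x \<longrightarrow>
      x = s' a x1 x2 \<or>
      (\<exists>b<k. \<exists>y<q. \<exists>w<q. 0 < e' a x1 x2 w \<and> e' a x1 x2 w < e' a x1 x2 x \<and> x = s' b y w) \<or>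
      (\<exists>b<k. \<exists>y<q. \<exists>w<q. 0 < e' a x1 y w \<and> e' a x1 y w < e' a x1 x2 x \<and> x = s' b w x2)"
    proof (intro allI impI)
      fix a x1 x2 x assume "a < k" "x1 < q" "x2 < q" "x < q" "0 < e' a x1 x2 x"
      then show "x = s' a x1 x2 \<or>
        (\<exists>b<k. \<exists>y<q. \<exists>w<q. 0 < e' a x1 x2 w \<and> e' a x1 x2 w < e' a x1 x2 x \<and> x = s' b y w) \<or>
        (\<exists>b<k. \<exists>y<q. \<exists>w<q. 0 < e' a x1 y w \<and> e' a x1 y w < e' a x1 x2 x \<and> x = s' b w x2)"
        using ext[rule_format, of a x1 x2 x] by (simp cong: conj_cong)
    qed
    show "\<forall>a<k. \<forall>m1<p. \<forall>m2<p. \<forall>x<q. \<rho>' (ms' a m1 m2) x \<longrightarrow>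
      (\<exists>x1<q. \<exists>x2<q. \<rho>' m1 x1 \<and> \<rho>' m2 x2 \<and> 0 < e' a x1 x2 x)"
    proof (intro allI impI)
      fix a m1 m2 x assume "a < k" "m1 < p" "m2 < p" "x < q" "\<rho>' (ms' a m1 m2) x"
      then show "\<exists>x1<q. \<exists>x2<q. \<rho>' m1 x1 \<and> \<rho>' m2 x2 \<and> 0 < e' a x1 x2 x"
        using above[rule_format, of a m1 m2 x] by (simp cong: conj_cong)
    qed
    show "\<forall>m<p. d' (mh' m) \<longrightarrow>
      (\<exists>x<q. \<rho>' m x \<and> d' x \<and> X (h' x)) \<and> (\<exists>x<q. \<rho>' m x \<and> d' x \<and> \<not> X (h' x))"
    proof (intro allI impI)
      fix m assume "m < p" "d' (mh' m)"
      then show "(\<exists>x<q. \<rho>' m x \<and> d' x \<and> X (h' x)) \<and> (\<exists>x<q. \<rho>' m x \<and> d' x \<and> \<not> X (h' x))"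
        using cofinal[rule_format, of m] by (simp cong: conj_cong)
    qed
    show "\<exists>x<q. d' x"
      using nonempty by (simp cong: conj_cong)
  qed
qed


lemma code_nth_encode_fun: "i < m \<Longrightarrow> encode_fun m f $ i = f i"
  by (simp add: encode_fun_def code_nth)

lemma code_nth_encode_fun2: "i < m \<Longrightarrow> j < n \<Longrightarrow> encode_fun2 m n f $ i $ j = f i j"
  by (simp add: encode_fun2_def code_nth_encode_fun)

section \<open>The automaton of a presentation\<close>

lemma letter_in_contexts: "a \<in> A \<Longrightarrow> letter a \<in> contexts A"
proof -
  assume a: "a \<in> A"
  have n: "nodes [Node (Some a) [Node None []]] = {[0], [0, 0]}"
  proof (intro equalityI subsetI)
    fix x assume "x \<in> nodes [Node (Some a) [Node None []]]"
    then show "x \<in> {[0], [0, 0]}"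
      by (auto simp: nodes_single)
  qed (auto simp: nodes_single)
  have "{y \<in> nodes (letter a). label (letter a) y = None} = {[0, 0]}"
    unfolding letter_def hole_def n by (auto simp: label_def)
  moreover have "is_leaf (letter a) [0, 0]"
    unfolding is_leaf_def letter_def hole_def n by simp
  ultimately show ?thesis
    using a unfolding contexts_def by (auto simp: letter_def hole_def)
qed

text \<open>The morphism sends \<open>Node a f # g\<close> to the image of the letter
  \<open>a\<close> acting on the value of \<open>f\<close>, multiplied by the value of
  \<open>g\<close> in the horizontal monoid. With these transitions, \<open>run\<close> computes the
  morphism on forests.\<close>

lemma presented_language:
  assumes "presents_regular_language c k L"
  defines "hs \<equiv> \<lambda>a x y. c $ 4 $ (c $ 7 $ (c $ 10 $ a) $ x) $ y"
  shows "c $ 0 = k" "\<exists>m. automaton k m (c $ 3) hs"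
    "L = {t \<in> forests {..<k}. c $ 11 $ run (c $ 3) hs t \<noteq> 0}"
proof -
  obtain m n F \<gamma> \<delta> X where F: "forest_algebra F"
    and carr: "carrier (horiz F) = {..<m}" "carrier (vert F) = {..<n}"
    and mor: "forest_algebra_morphism (free_forest_algebra {..<k}) F \<gamma> \<delta>"
    and L: "L = {t \<in> forests {..<k}. \<gamma> t \<in> X}"
    and c: "c = encode_presentation k m n F \<delta> X"
    using assms(1) unfolding presents_regular_language_def by blast
  interpret forest_algebra F
    by (rule F)
  interpret H: monoid "horiz F"
    by (rule horiz_monoid)
  let ?F = "forests {..<k}"
  note free = free_forest_algebra_def monoid_morphism_def hom_def
  have \<gamma>: "\<gamma> t < m" if "t \<in> ?F" for t
    using mor that carr unfolding forest_algebra_morphism_def free by auto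
  have \<gamma>_Nil: "\<gamma> [] = \<one>\<^bsub>horiz F\<^esub>"
    using mor unfolding forest_algebra_morphism_def free by simp
  have \<gamma>_append: "\<gamma> (f @ g) = \<gamma> f \<otimes>\<^bsub>horiz F\<^esub> \<gamma> g" if "f \<in> ?F" "g \<in> ?F" for f g
    using mor that unfolding forest_algebra_morphism_def free by simp
  have \<delta>: "\<delta> (letter a) < n" if "a < k" for a
    using mor letter_in_contexts[of a "{..<k}"] that carr
    unfolding forest_algebra_morphism_def free by auto
  have \<gamma>_letter: "\<gamma> [Node a f] = act F (\<delta> (letter a)) (\<gamma> f)" if "a < k" "f \<in> ?F" for a f
  proof -
    have "\<gamma> (fill id (letter a) f) = act F (\<delta> (letter a)) (\<gamma> f)"
      using mor letter_in_contexts[of a "{..<k}"] that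
      unfolding forest_algebra_morphism_def free by simp
    then show ?thesis
      by (simp add: fill_def letter_def hole_def)
  qed
  have code: "c $ 0 = k" "c $ 3 = \<one>\<^bsub>horiz F\<^esub>" "c $ 4 = encode_fun2 m m (mult (horiz F))"
    "c $ 7 = encode_fun2 n m (act F)" "c $ 10 = encode_fun k (\<lambda>a. \<delta> (letter a))"
    "c $ 11 = encode_fun m (\<lambda>h. of_bool (h \<in> X))"
    unfolding c encode_presentation_def by (simp_all add: code_nth del: list_encode.simps)
  show "c $ 0 = k"
    by (rule code)
  have act: "act F (\<delta> (letter a)) x < m" if "a < k" "x < m" for a x
    using act_closed[of "\<delta> (letter a)" x] \<delta> that carr by simp
  have hs: "hs a x y = act F (\<delta> (letter a)) x \<otimes>\<^bsub>horiz F\<^esub> y" if "a < k" "x < m" "y < m" for a x y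
    unfolding hs_def code using that \<delta> act by (simp add: code_nth_encode_fun code_nth_encode_fun2)
  have "automaton k m (c $ 3) hs"
    unfolding automaton_def code using H.one_closed H.m_closed carr act hs by auto
  then show "\<exists>m. automaton k m (c $ 3) hs"
    by blast
  have "run (c $ 3) hs t = \<gamma> t" if "t \<in> ?F" for t
    using that
  proof (induction t rule: forest_induct)
    case Nil
    then show ?case
      by (simp add: code \<gamma>_Nil)
  next
    case (Cons a f g)
    then show ?case
      using \<gamma>_append[of "[Node a f]" g] \<gamma>_letter[of a f] hs \<gamma> by simp
  qed
  then show "L = {t \<in> ?F. c $ 11 $ run (c $ 3) hs t \<noteq> 0}"
    unfolding L code(6) using \<gamma> by (auto simp: code_nth_encode_fun)
qed

lemma testable_code_iff:
  assumes "presents_regular_language c k L"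
  shows "(\<exists>w. testable_code c w) \<longleftrightarrow> cca_piecewise_testable {..<k} L"
proof -
  note c = presented_language[OF assms]
  let ?hs = "\<lambda>a x y. c $ 4 $ (c $ 7 $ (c $ 10 $ a) $ x) $ y" and ?X = "\<lambda>x. c $ 11 $ x \<noteq> 0"
  show ?thesis
  proof
    assume "\<exists>w. testable_code c w"
    then obtain w where "testable_code c w"
      by blast
    from testable_cert.sound[OF this[unfolded testable_code_def]]
    show "cca_piecewise_testable {..<k} L"
      by (simp only: c)
  next
    assume "cca_piecewise_testable {..<k} L"
    then obtain q z s h leq where C: "testable_cert k (c $ 3) ?hs ?X q z s h leq"
      using testable_cert_complete[of k _ "c $ 3" ?hs ?X] c(2,3) by metis
    obtain ts where ts: "\<forall>a<k. \<forall>x<q. \<forall>y<q. ts $ a $ x $ y = s a x y"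
      using table3 by (rule exE)
    obtain th where th: "\<forall>x<q. th $ x = h x"
      using table1 by (rule exE)
    obtain tl where tl: "\<forall>x<q. \<forall>y<q. tl $ x $ y = of_bool (leq x y)"
      using table2 by (rule exE)
    have "testable_code c (list_encode [q, z, ts, th, tl])"
      unfolding testable_code_def c(1)
      by (rule testable_cert_cong[of k "c $ 3" ?hs ?X _ _ s h leq])
         (use C ts th tl in \<open>simp_all add: code_nth del: list_encode.simps\<close>)
    then show "\<exists>w. testable_code c w" ..
  qed
qed

lemma nontestable_code_iff:
  assumes "presents_regular_language c k L"
  shows "(\<exists>w. nontestable_code c w) \<longleftrightarrow> \<not> cca_piecewise_testable {..<k} L"
proof -
  note c = presented_language[OF assms]
  let ?hs = "\<lambda>a x y. c $ 4 $ (c $ 7 $ (c $ 10 $ a) $ x) $ y" and ?X = "\<lambda>x. c $ 11 $ x \<noteq> 0"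
  show ?thesis
  proof
    assume "\<exists>w. nontestable_code c w"
    then obtain w where "nontestable_code c w"
      by blast
    from nontestable_cert.sound[OF this[unfolded nontestable_code_def]]
    show "\<not> cca_piecewise_testable {..<k} L"
      by (simp only: c not_False_eq_True)
  next
    assume not: "\<not> cca_piecewise_testable {..<k} L"
    obtain m where m: "automaton k m (c $ 3) ?hs"
      using c(2) by (rule exE)
    have "\<exists>q z s h p mz ms mh r e \<rho> d.
        nontestable_cert k (c $ 3) ?hs ?X q z s h p mz ms mh r e \<rho> d \<and> (\<forall>m<p. mh m < q)"
      by (rule nontestable_cert_complete[OF m not[unfolded c(3)]])
    then obtain q z s h p mz ms mh r e \<rho> d where
      C: "nontestable_cert k (c $ 3) ?hs ?X q z s h p mz ms mh r e \<rho> d" and mh: "\<forall>m<p. mh m < q"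
      by (elim exE conjE)
    obtain ts where ts: "\<forall>a<k. \<forall>x<q. \<forall>y<q. ts $ a $ x $ y = s a x y"
      using table3 by (rule exE)
    obtain th where th: "\<forall>x<q. th $ x = h x"
      using table1 by (rule exE)
    obtain tms where tms: "\<forall>a<k. \<forall>x<p. \<forall>y<p. tms $ a $ x $ y = ms a x y"
      using table3 by (rule exE)
    obtain tmh where tmh: "\<forall>x<p. tmh $ x = mh x"
      using table1 by (rule exE)
    obtain tr where tr: "\<forall>x<q. tr $ x = r x"
      using table1 by (rule exE)
    obtain te where te: "\<forall>a<k. \<forall>x1<q. \<forall>x2<q. \<forall>x<q. te $ a $ x1 $ x2 $ x = e a x1 x2 x"
      using table4 by (rule exE)
    obtain tp where tp: "\<forall>m<p. \<forall>x<q. tp $ m $ x = of_bool (\<rho> m x)"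
      using table2 by (rule exE)
    obtain td where td: "\<forall>x<q. td $ x = of_bool (d x)"
      using table1 by (rule exE)
    have "nontestable_code c (list_encode [q, z, ts, th, p, mz, tms, tmh, tr, te, tp, td])"
      unfolding nontestable_code_def c(1)
      by (rule nontestable_cert_cong[of k "c $ 3" ?hs ?X _ _ s h _ _ ms mh r e \<rho> d])
         (use C mh ts th tms tmh tr te tp td in \<open>simp_all add: code_nth del: list_encode.simps\<close>)
    then show "\<exists>w. nontestable_code c w" ..
  qed
qed

theorem corollary22:
  shows "\<exists>p. \<forall>c k L. presents_regular_language c k L \<longrightarrow>
    computes p [c] (if cca_piecewise_testable {..<k} L then 1 else 0)"
proof -
  \<comment> \<open>Negated, because minimization looks for the value zero.\<close>
  have "decidable (\<lambda>x. \<not> (testable_code (fst (prod_decode x)) (snd (prod_decode x)) \<or>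
      nontestable_code (fst (prod_decode x)) (snd (prod_decode x))))"
    by (intro decidable_not decidable_disj decidable_testable_code decidable_nontestable_code)
  then obtain ps where "\<And>x. computes ps [x] (of_bool (\<not> (testable_code (fst (prod_decode x)) (snd (prod_decode x)) \<or>
      nontestable_code (fst (prod_decode x)) (snd (prod_decode x)))))"
    unfolding computable_def by blast
  from this[of "prod_encode (_, _)"] have ps: "computes ps [prod_encode (c, w)]
      (of_bool (\<not> (testable_code c w \<or> nontestable_code c w)))" for c w
    by simp
  obtain pt where "\<And>x. computes pt [x] (of_bool (testable_code (fst (prod_decode x)) (snd (prod_decode x))))"
    using decidable_testable_code unfolding computable_def by blast
  from this[of "prod_encode (_, _)"]
  have pt: "computes pt [prod_encode (c, w)] (of_bool (testable_code c w))" for c w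
    by simp
  obtain pe where pe: "\<And>x y. computes pe [x, y] (prod_encode (x, y))"
    using computable2_prod_encode unfolding computable2_def by blast
  \<comment> \<open>Minimization puts the candidate \<open>w\<close> before the argument
    \<open>c\<close>, so the projections exchange them to form the code of
    \<open>(c, w)\<close>.\<close>
  let ?search = "Minimize (Comp ps [Comp pe [Proj 1, Proj 0]])"
  have "computes (Comp pt [Comp pe [Proj 0, ?search]]) [c]
      (if cca_piecewise_testable {..<k} L then 1 else 0)"
    if c: "presents_regular_language c k L" for c k L
  proof -
    let ?f = "\<lambda>w. of_bool (\<not> (testable_code c w \<or> nontestable_code c w)) :: nat"
    note iff = testable_code_iff[OF c] nontestable_code_iff[OF c]
    have ex: "\<exists>w. ?f w = 0"
      using iff by auto
    define w where "w = (LEAST w. ?f w = 0)"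
    have "computes (Comp ps [Comp pe [Proj 1, Proj 0]]) [w, c] (?f w)" for w
      by (rule computes_Comp1[OF computes_Comp2[OF _ _ pe] ps]) (auto intro!: computes_Proj)
    then have search: "computes ?search [c] w"
      unfolding w_def using ex by (rule computes_Minimize)
    have "?f w = 0"
      unfolding w_def by (rule LeastI_ex[OF ex])
    \<comment> \<open>Each kind of witness exists only in its own case, so the kind of the witness
      found tells the answer.\<close>
    then have "testable_code c w \<longleftrightarrow> cca_piecewise_testable {..<k} L"
      using iff by auto
    moreover have "computes (Comp pt [Comp pe [Proj 0, ?search]]) [c] (of_bool (testable_code c w))"
      by (rule computes_Comp1[OF computes_Comp2[OF _ search pe] pt]) (auto intro!: computes_Proj)
    ultimately show ?thesis
      by (simp add: of_bool_def)
  qed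
  then show ?thesis
    by blast
qed

end
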